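(* Let $X:\Omega\to\mathbb R^3$ be a minimal surface such that $X=\mathfrak B(c)$ for a self-CPG curve $c:I\to\mathbb R^3$, $I\subset\Omega$. Then the adjoint surface $X^*:\Omega\to\mathbb R^3$ is generated by another self-CPG curve $c^*:I'\to\mathbb R^3$, with $I'\subset\Omega$; that is, $X^*=\mathfrak B(c^* )$.
   Context: Identify $\mathbb R^2\cong\mathbb C$, $w=u+iv$. $I\subset\mathbb R$ is an open interval symmetric about $0$, and $\Omega\subset\mathbb C$ is a simply connected domain containing $I$ with $\tau(\Omega)=\Omega$, $\lambda(\Omega)=\Omega$, where $\tau(w)=\bar w$, $\lambda(w)=iw$. A minimal surface is a nonconstant map $X:\Omega\to\mathbb R^3$ with $\Delta X=0$, $|X_u|^2=|X_v|^2$, $\langle X_u,X_v\rangle=0$. Its adjoint surface $X^*$ is defined (up to translation) by $X_u=X^*_v$, $X_v=-X^*_u$, so that $f=X+iX^*$ is holomorphic. Björling transformation of a planar curve. Let $c$ be a regular real analytic curve contained in a plane of $\mathbb R^3$, and let $n$ be its (unit, real analytic) principal normal field in that plane. Using holomorphic extensions of $c$ and $n$ to $\Omega$, $\mathfrak B(c)$ is the minimal surface $$\mathfrak B(c)(w)=\Re\Big(c(w)-i\int_{0}^{w} n(z)\times c'(z)\,dz\Big),$$ the unique minimal surface containing $c$ (as $X(t)=c(t)$, $t\in I$) with unit normal $n$ along $c$. More generally, for a segment $I'\subset\Omega$ and a curve $c^*$ parameterizing $X^*|_{I'}$, "$X^*=\mathfrak B(c^* )$" means that $c^*$ is a planar curve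 whose principal normal is, up to sign, the surface normal of $X^*$ along $I'$; so $\mathfrak B(c^* )$ and $X^*$ agree up to a conformal (or anticonformal) change of parameter. Perpendicular symmetric curve. A planar curve $c$ is perpendicular symmetric with respect to a line $\mathscr L$ of its plane (with direction vector $a\ne0$) if $c$ is symmetric under reflection in $\mathscr L$ and there is $t_0$ with $c(t_0)\in\mathscr L$ and $\langle\dot c(t_0),a\rangle=0$; $c(t_0)$ is the symmetry vertex. It is non-degenerate if its principal normal (curvature vector) does not vanish at the symmetry vertex. Parameters are chosen with $t_0=0$ and so that the reflection sends $c(t)$ to $c(-t)$. Self-CPG curve. Let $\Lambda=\begin{pmatrix}-1&0&0\\0&0&-1\\0&1&0\end{pmatrix}$. A non-degenerate perpendicular symmetric curve $c$ is self-CPG if, after a rigid motion of $\mathbb R^3$ placing $c$ in the $xy$-plane, symmetric with respect to the $x$-axis, and a suitable choice of regular symmetric parameter $t$, the surface $X=\mathfrak B(c)$ satisfies $X(it)=\Lambda X(t)$ for all $t\in I$. *)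

theory Defs
  imports "HOL-Complex_Analysis.Complex_Analysis"
begin

text \<open>The parameter plane is \<open>complex\<close>, with \<open>w = u + i v\<close>; space is \<open>real ^ 3\<close>. Curves and surfaces
  are total functions of which only the values on the stated interval or domain matter.\<close>

definition symmetric_interval :: "real set \<Rightarrow> bool" where
  "symmetric_interval I \<longleftrightarrow> open I \<and> is_interval I \<and> 0 \<in> I \<and> uminus ` I = I"

definition symmetric_domain :: "complex set \<Rightarrow> bool" where
  "symmetric_domain \<Omega> \<longleftrightarrow> open \<Omega> \<and> \<Omega> \<noteq> {} \<and> connected \<Omega> \<and> simply_connected \<Omega> \<and>
     cnj ` \<Omega> = \<Omega> \<and> (\<lambda>w. \<i> * w) ` \<Omega> = \<Omega>"


subsection \<open>Minimal surfaces and their adjoints\<close>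

definition partial_u :: "(complex \<Rightarrow> real ^ 3) \<Rightarrow> complex \<Rightarrow> real ^ 3" where
  "partial_u X w = vector_derivative (\<lambda>t::real. X (w + of_real t)) (at 0)"

definition partial_v :: "(complex \<Rightarrow> real ^ 3) \<Rightarrow> complex \<Rightarrow> real ^ 3" where
  "partial_v X w = vector_derivative (\<lambda>t::real. X (w + \<i> * of_real t)) (at 0)"

definition C2_on :: "complex set \<Rightarrow> (complex \<Rightarrow> real ^ 3) \<Rightarrow> bool" where
  "C2_on \<Omega> X \<longleftrightarrow>
     (\<forall>w\<in>\<Omega>. X differentiable (at w) \<and>
            partial_u X differentiable (at w) \<and> partial_v X differentiable (at w)) \<and>
     continuous_on \<Omega> (partial_u (partial_u X)) \<and> continuous_on \<Omega> (partial_v (partial_u X)) \<and>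
     continuous_on \<Omega> (partial_u (partial_v X)) \<and> continuous_on \<Omega> (partial_v (partial_v X))"

text \<open>Branch points (zeros of both partial derivatives) are not excluded.\<close>

definition minimal_surface :: "complex set \<Rightarrow> (complex \<Rightarrow> real ^ 3) \<Rightarrow> bool" where
  "minimal_surface \<Omega> X \<longleftrightarrow>
     C2_on \<Omega> X \<and> \<not> X constant_on \<Omega> \<and>
     (\<forall>w\<in>\<Omega>. partial_u (partial_u X) w + partial_v (partial_v X) w = 0 \<and>
            (norm (partial_u X w))\<^sup>2 = (norm (partial_v X w))\<^sup>2 \<and>
            partial_u X w \<bullet> partial_v X w = 0)"

definition adjoint_surface ::
  "complex set \<Rightarrow> (complex \<Rightarrow> real ^ 3) \<Rightarrow> (complex \<Rightarrow> real ^ 3) \<Rightarrow> bool" where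
  "adjoint_surface \<Omega> X Xs \<longleftrightarrow>
     (\<forall>w\<in>\<Omega>. Xs differentiable (at w) \<and>
            partial_u X w = partial_v Xs w \<and> partial_v X w = - partial_u Xs w)"

text \<open>Only meaningful where the surface is immersed.\<close>

definition surface_normal :: "(complex \<Rightarrow> real ^ 3) \<Rightarrow> complex \<Rightarrow> real ^ 3" where
  "surface_normal X w =
     (1 / norm (cross3 (partial_u X w) (partial_v X w))) *\<^sub>R cross3 (partial_u X w) (partial_v X w)"


subsection \<open>Planar curves\<close>

definition real_analytic_on :: "(real \<Rightarrow> 'a :: real_normed_vector) \<Rightarrow> real set \<Rightarrow> bool" where
  "real_analytic_on g I \<longleftrightarrow>
     (\<forall>t\<in>I. \<exists>r>0. \<exists>a :: nat \<Rightarrow> 'a. \<forall>s. \<bar>s - t\<bar> < r \<longrightarrow> (\<lambda>k. (s - t) ^ k *\<^sub>R a k) sums g s)"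

definition velocity :: "(real \<Rightarrow> 'a :: real_normed_vector) \<Rightarrow> real \<Rightarrow> 'a" where
  "velocity c t = vector_derivative c (at t)"

text \<open>The second derivative with respect to arc length, in terms of an arbitrary regular
  parameter: the part of \<open>c''\<close> orthogonal to \<open>c'\<close>, divided by \<open>|c'|\<^sup>2\<close>.\<close>

definition curvature_vector :: "(real \<Rightarrow> real ^ 3) \<Rightarrow> real \<Rightarrow> real ^ 3" where
  "curvature_vector c t =
     (let d = velocity c t; dd = velocity (velocity c) t
      in (1 / (d \<bullet> d)) *\<^sub>R (dd - ((dd \<bullet> d) / (d \<bullet> d)) *\<^sub>R d))"

definition regular_analytic_curve :: "real set \<Rightarrow> (real \<Rightarrow> 'a :: real_normed_vector) \<Rightarrow> bool" where
  "regular_analytic_curve I c \<longleftrightarrow> real_analytic_on c I \<and> (\<forall>t\<in>I. velocity c t \<noteq> 0)"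

text \<open>The plane through \<open>p\<close> with normal vector \<open>e\<close>.\<close>

definition plane_through :: "real ^ 3 \<Rightarrow> real ^ 3 \<Rightarrow> (real ^ 3) set" where
  "plane_through p e = {x. (x - p) \<bullet> e = 0}"

text \<open>An analytic unit normal field of a planar curve inside its plane is unique up to a global
  sign, and is automatically parallel to the curvature vector. Since the curvature vector may
  change sides at inflection points, its direction can only be prescribed at one point; the last
  clause does so at the base parameter \<open>0\<close> (and is void if the curvature vanishes there).\<close>

definition principal_normal_field ::
  "real set \<Rightarrow> (real \<Rightarrow> real ^ 3) \<Rightarrow> (real \<Rightarrow> real ^ 3) \<Rightarrow> bool" where
  "principal_normal_field I c n \<longleftrightarrow>
     real_analytic_on n I \<and>
     (\<exists>p e. e \<noteq> 0 \<and> c ` I \<subseteq> plane_through p e \<and> (\<forall>t\<in>I. n t \<bullet> e = 0)) \<and>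
     (\<forall>t\<in>I. norm (n t) = 1 \<and> n t \<bullet> velocity c t = 0) \<and>
     curvature_vector c 0 = norm (curvature_vector c 0) *\<^sub>R n 0"


subsection \<open>The Bjoerling transformation\<close>

definition complex_cross :: "complex ^ 3 \<Rightarrow> complex ^ 3 \<Rightarrow> complex ^ 3" where
  "complex_cross a b =
     vector [a$2 * b$3 - a$3 * b$2, a$3 * b$1 - a$1 * b$3, a$1 * b$2 - a$2 * b$1]"

definition holomorphic_extension ::
  "complex set \<Rightarrow> real set \<Rightarrow> (real \<Rightarrow> real ^ 3) \<Rightarrow> (complex \<Rightarrow> complex ^ 3) \<Rightarrow> bool" where
  "holomorphic_extension \<Omega> I g G \<longleftrightarrow>
     (\<forall>k. (\<lambda>z. G z $ k) holomorphic_on \<Omega>) \<and>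
     (\<forall>t\<in>I. \<forall>k. G (of_real t) $ k = of_real (g t $ k))"

text \<open>\<open>is_bjoerling \<Omega> I c X\<close> says that the holomorphic extensions of \<open>c\<close> and of its principal normal
  exist on \<open>\<Omega>\<close> and that \<open>X\<close> is the resulting surface there. They are unique on a domain containing
  \<open>I\<close>, so this determines \<open>X\<close> on \<open>\<Omega>\<close> if the curvature of \<open>c\<close> does not vanish at \<open>0\<close>. The
  integral may be taken along any path in \<open>\<Omega>\<close> from \<open>0\<close> to \<open>w\<close>.\<close>

definition is_bjoerling ::
  "complex set \<Rightarrow> real set \<Rightarrow> (real \<Rightarrow> real ^ 3) \<Rightarrow> (complex \<Rightarrow> real ^ 3) \<Rightarrow> bool" where
  "is_bjoerling \<Omega> I c X \<longleftrightarrow>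
     regular_analytic_curve I c \<and>
     (\<exists>n C N. principal_normal_field I c n \<and>
        holomorphic_extension \<Omega> I c C \<and> holomorphic_extension \<Omega> I n N \<and>
        (\<forall>w\<in>\<Omega>. \<forall>g. valid_path g \<and> path_image g \<subseteq> \<Omega> \<and> pathstart g = 0 \<and> pathfinish g = w \<longrightarrow>
           (\<forall>k. X w $ k =
              Re (C w $ k - \<i> * contour_integral g
                    (\<lambda>z. complex_cross (N z) (\<chi> j. deriv (\<lambda>\<zeta>. C \<zeta> $ j) z) $ k)))))"

text \<open>The meaning of \<open>X = B(c)\<close> for a curve \<open>c\<close> lying over an arc \<open>\<gamma> ` J\<close> of the parameter domain
  that need not be the real axis: \<open>c\<close> parametrizes the restriction of \<open>X\<close> to that arc, and its
  principal normal is, up to sign, the surface normal.\<close>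

definition generated_along ::
  "complex set \<Rightarrow> (complex \<Rightarrow> real ^ 3) \<Rightarrow> real set \<Rightarrow> (real \<Rightarrow> complex) \<Rightarrow> (real \<Rightarrow> real ^ 3) \<Rightarrow> bool"
where
  "generated_along \<Omega> X J \<gamma> c \<longleftrightarrow>
     regular_analytic_curve J \<gamma> \<and> inj_on \<gamma> J \<and> \<gamma> ` J \<subseteq> \<Omega> \<and>
     regular_analytic_curve J c \<and> (\<forall>t\<in>J. c t = X (\<gamma> t)) \<and>
     (\<exists>n. principal_normal_field J c n \<and>
        (\<forall>t\<in>J. n t = surface_normal X (\<gamma> t) \<or> n t = - surface_normal X (\<gamma> t)))"


subsection \<open>Self-CPG curves\<close>

text \<open>The half turn about the line \<open>p + \<real> a\<close>; on each plane containing this line it is the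
  reflection in the line.\<close>

definition reflect_line :: "real ^ 3 \<Rightarrow> real ^ 3 \<Rightarrow> real ^ 3 \<Rightarrow> real ^ 3" where
  "reflect_line p a x = 2 *\<^sub>R (p + (((x - p) \<bullet> a) / (a \<bullet> a)) *\<^sub>R a) - x"

text \<open>The line is \<open>p + \<real> a\<close>, contained in the plane of the curve, and the symmetry vertex
  is \<open>c 0\<close>.\<close>

definition perpendicular_symmetric :: "real set \<Rightarrow> (real \<Rightarrow> real ^ 3) \<Rightarrow> bool" where
  "perpendicular_symmetric I c \<longleftrightarrow>
     regular_analytic_curve I c \<and>
     (\<exists>p a e. e \<noteq> 0 \<and> a \<noteq> 0 \<and> a \<bullet> e = 0 \<and> c ` I \<subseteq> plane_through p e \<and>
        (\<forall>t\<in>I. reflect_line p a (c t) = c (- t)) \<and>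
        (\<exists>s. c 0 = p + s *\<^sub>R a) \<and> velocity c 0 \<bullet> a = 0)"

definition nondegenerate :: "(real \<Rightarrow> real ^ 3) \<Rightarrow> bool" where
  "nondegenerate c \<longleftrightarrow> curvature_vector c 0 \<noteq> 0"

definition Lambda :: "real ^ 3 ^ 3" where
  "Lambda = vector [vector [-1, 0,  0],
                    vector [ 0, 0, -1],
                    vector [ 0, 1,  0]]"

definition rigid_motion :: "(real ^ 3 \<Rightarrow> real ^ 3) \<Rightarrow> bool" where
  "rigid_motion T \<longleftrightarrow> (\<exists>A b. orthogonal_matrix A \<and> det A = 1 \<and> T = (\<lambda>x. A *v x + b))"

text \<open>\<open>suitable_parameter I c J \<phi>\<close>: the regular symmetric change of parameter \<open>t = \<phi> s\<close>, \<open>s \<in> J\<close>,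
  exhibits \<open>c\<close> as a self-CPG curve.\<close>

definition suitable_parameter ::
  "real set \<Rightarrow> (real \<Rightarrow> real ^ 3) \<Rightarrow> real set \<Rightarrow> (real \<Rightarrow> real) \<Rightarrow> bool" where
  "suitable_parameter I c J \<phi> \<longleftrightarrow>
     symmetric_interval J \<and> regular_analytic_curve J \<phi> \<and> bij_betw \<phi> J I \<and>
     (\<forall>s\<in>J. \<phi> (- s) = - \<phi> s) \<and>
     (\<exists>T k. rigid_motion T \<and> k = T \<circ> c \<circ> \<phi> \<and>
        (\<forall>s\<in>J. k s $ 3 = 0 \<and> reflect_line 0 (axis 1 1) (k s) = k (- s)) \<and>
        (\<exists>\<Omega> X. symmetric_domain \<Omega> \<and> of_real ` J \<subseteq> \<Omega> \<and> is_bjoerling \<Omega> J k X \<and>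
           (\<forall>s\<in>J. X (\<i> * of_real s) = Lambda *v X (of_real s))))"

definition self_CPG :: "real set \<Rightarrow> (real \<Rightarrow> real ^ 3) \<Rightarrow> bool" where
  "self_CPG I c \<longleftrightarrow>
     symmetric_interval I \<and> perpendicular_symmetric I c \<and> nondegenerate c \<and>
     (\<exists>J \<phi>. suitable_parameter I c J \<phi>)"

text \<open>The arc traced by \<open>\<gamma>\<close> is a straight segment, traversed affinely. A rotational symmetry that
  \<open>X\<close> has in a suitable parameter \<open>s\<close> makes the symmetric curve of the adjoint surface lie over a
  segment of the complexified \<open>s\<close>-plane, so over a straight segment of \<open>\<Omega>\<close> when the coordinate
  of \<open>\<Omega>\<close> is itself suitable, but only over an analytic arc in general.\<close>

definition affine_arc :: "real set \<Rightarrow> (real \<Rightarrow> complex) \<Rightarrow> bool" where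
  "affine_arc J \<gamma> \<longleftrightarrow> (\<exists>p q. q \<noteq> 0 \<and> (\<forall>t\<in>J. \<gamma> t = p + of_real t * q))"

end

theory Submission
  imports Defs
begin

no_notation fps_nth (infixl "$" 75)

text \<open>In the suitable parameter the surface of a self-CPG curve is the real part of a null curve
  \<open>F(z) = (A(z), B(z), -B(iz))\<close> with \<open>A\<close>, \<open>B\<close> real on the real axis, \<open>B\<close> odd and \<open>A(iz) = -A(z)\<close>;
  equivalently \<open>F(iz) = \<Lambda> F(z)\<close>. The adjoint surface is the imaginary part of \<open>F\<close>. With
  \<open>\<omega> = exp(i\<pi>/4)\<close> and \<open>R\<close> the rotation by \<open>\<pi>/4\<close> about the \<open>x\<close>-axis, which commutes with \<open>\<Lambda>\<close>,
  the null curve \<open>z \<mapsto> -i R F(\<omega>z)\<close> is again of this form, so the adjoint surface is generated by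
  its restriction to the bisector \<open>\<omega>\<real>\<close>. As the curve may be taken over a short arc, everything
  happens near \<open>0\<close>; the sign of the normal field is pinned down by the curvature at the symmetry
  vertex.\<close>

section \<open>Holomorphic functions near the real axis\<close>

text \<open>Why the bisector: for w on \<open>\<omega>\<real>\<close> the symmetries give cnj w =
  -iw, hence A(w) is imaginary and B(iw) = -cnj (B(w)). There Im F = (Im A, Im B, -Im B) lies in the
  plane y + z = 0, and R is the rotation carrying this plane to z = 0. The factor -i turns Im F into
  a real part. The obstacle lies on the other side. Being self-CPG is a statement about a Bjoerling
  surface Y of a moved and reparametrized curve, on a domain of its own; X comes with another
  domain, another parameter and its own choice of normal field. The normal field of a planar curve
  is determined only up to sign, and the two signs give X(w) and X(cnj w), so X and Y cannot be
  identified before the signs are compared. Once the curve is horizontal, the derivative of the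
  Bjoerling integral is vertical, and its only component is a holomorphic square root of a function
  determined by the curve. This root is nonzero at 0, so its value there determines it; here
  nondegeneracy enters.\<close>

lemma holomorphic_eq_on_reals:
  assumes "f holomorphic_on ball 0 r" "g holomorphic_on ball 0 r"
    and eq: "\<And>t. \<bar>t\<bar> < r \<Longrightarrow> f (of_real t) = g (of_real t)"
    and "z \<in> ball (0::complex) r"
  shows "f z = g z"
proof -
  have "r > 0" using \<open>z \<in> ball 0 r\<close> by (metis ball_eq_empty empty_iff not_le)
  define U where "U = (of_real ` {-r<..<r} :: complex set)"
  have lim: "(0::complex) islimpt U"
    unfolding islimpt_approachable
  proof (intro allI impI)
    fix e :: real assume "e > 0"
    define t where "t = min (e/2) (r/2)"
    have "t > 0" "t < e" "t < r" using \<open>e > 0\<close> \<open>r > 0\<close> by (auto simp: t_def)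
    then have "of_real t \<in> U" "complex_of_real t \<noteq> 0" "dist (complex_of_real t) 0 < e"
      by (auto simp: U_def)
    then show "\<exists>x'\<in>U. x' \<noteq> 0 \<and> dist x' 0 < e" by blast
  qed
  have "(\<lambda>z. f z - g z) z = 0"
  proof (rule analytic_continuation [of "\<lambda>z. f z - g z" "ball 0 r" U 0])
    show "U \<subseteq> ball 0 r" by (auto simp: U_def)
    show "f w - g w = 0" if "w \<in> U" for w
      using that eq by (force simp: U_def)
  qed (use assms lim \<open>r > 0\<close> in \<open>auto intro!: holomorphic_intros\<close>)
  then show ?thesis by simp
qed

text \<open>Near 0 the factor f + g of f^2 - g^2 stays away from 0, so f - g vanishes there and, by
  the identity theorem, on the whole disc. This is how a sign known at the vertex
  propagates.\<close>

lemma holomorphic_eq_of_power2_eq: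
  assumes f: "f holomorphic_on ball 0 r" and g: "g holomorphic_on ball 0 r" and "r > 0"
    and sq: "\<And>z. z \<in> ball 0 r \<Longrightarrow> (f z)\<^sup>2 = (g z)\<^sup>2"
    and "f 0 = g 0" "f 0 \<noteq> 0" and z: "z \<in> ball (0::complex) r"
  shows "f z = g z"
proof -
  have "continuous_on (ball 0 r) (\<lambda>z. f z + g z)"
    by (intro continuous_intros holomorphic_on_imp_continuous_on f g)
  then have "isCont (\<lambda>z. f z + g z) 0"
    using \<open>r > 0\<close> by (simp add: continuous_on_eq_continuous_at)
  moreover have "f 0 + g 0 \<noteq> 0" using assms by auto
  ultimately obtain e where e: "e > 0" "\<And>z. dist 0 z < e \<Longrightarrow> f z + g z \<noteq> 0"
    using continuous_at_avoid by blast
  define s where "s = min e r"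
  have s: "s > 0" "s \<le> e" "s \<le> r" using e \<open>r > 0\<close> by (auto simp: s_def)
  have "f w = g w" if "w \<in> ball 0 s" for w
  proof -
    have "(f w + g w) * (f w - g w) = 0"
      using sq[of w] that s by (simp add: power2_eq_square algebra_simps)
    then show ?thesis using e(2)[of w] that s by auto
  qed
  then have "f w - g w = 0" if "w \<in> ball 0 s" for w
    using that by simp
  then show ?thesis
    using analytic_continuation_open[of "ball 0 s" "ball 0 r" f g z] f g s z
    by (metis (mono_tags, lifting) ball_eq_empty connected_ball eq_iff_diff_eq_0 not_le open_ball subset_ball)
qed

text \<open>Schwarz reflection: \<open>cnj \<circ> f \<circ> cnj\<close> is holomorphic and agrees
  with \<open>f\<close> on the real diameter.\<close>

lemma holomorphic_cnj_symmetric: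
  assumes f: "f holomorphic_on ball 0 r"
    and re: "\<And>t. \<bar>t\<bar> < r \<Longrightarrow> f (of_real t) \<in> \<real>" and z: "z \<in> ball (0::complex) r"
  shows "f (cnj z) = cnj (f z)"
proof -
  have img: "cnj ` ball 0 r = ball 0 r"
    by (auto simp: image_cnj_conv_vimage_cnj)
  have "(cnj \<circ> f \<circ> cnj) z = f z"
  proof (rule holomorphic_eq_on_reals[OF _ f _ z])
    show "cnj \<circ> f \<circ> cnj holomorphic_on ball 0 r"
      by (rule holomorphic_on_compose_cnj_cnj) (auto simp: img f)
    show "(cnj \<circ> f \<circ> cnj) (of_real t) = f (of_real t)" if "\<bar>t\<bar> < r" for t
      using re[OF that] by (simp add: Reals_cnj_iff)
  qed
  then show ?thesis by (metis comp_apply complex_cnj_cnj)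
qed

lemma real_on_reals:
  assumes f: "f holomorphic_on ball 0 r" and "f 0 \<in> \<real>"
    and d: "\<And>t. \<bar>t\<bar> < r \<Longrightarrow> deriv f (of_real t) \<in> \<real>" and t: "\<bar>t\<bar> < r"
  shows "f (complex_of_real t) \<in> \<real>"
proof -
  have D: "((\<lambda>s. Im (f (of_real s))) has_vector_derivative 0) (at s)" if "\<bar>s\<bar> < r" for s
  proof -
    have "(f has_field_derivative deriv f (of_real s)) (at (complex_of_real s))"
      using that by (intro holomorphic_derivI[OF f]) auto
    then have "((\<lambda>s. f (of_real s)) has_vector_derivative deriv f (of_real s)) (at s)"
      by (rule has_vector_derivative_real_field)
    then have "((\<lambda>s. Im (f (of_real s))) has_vector_derivative Im (deriv f (of_real s))) (at s)"
      by (rule bounded_linear.has_vector_derivative[OF bounded_linear_Im])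
    then show ?thesis using d[OF that] by (simp add: complex_is_Real_iff)
  qed
  have "\<exists>c. \<forall>x\<in>{-r<..<r}. Im (f (of_real x)) = c"
  proof (rule has_derivative_zero_constant)
    fix x assume "x \<in> {-r<..<r}"
    then have "\<bar>x\<bar> < r" by auto
    from D[OF this] have "((\<lambda>s. Im (f (of_real s))) has_derivative (\<lambda>h. 0)) (at x)"
      by (simp add: has_vector_derivative_def)
    then show "((\<lambda>s. Im (f (of_real s))) has_derivative (\<lambda>h. 0)) (at x within {-r<..<r})"
      by (rule has_derivative_at_withinI)
  qed simp
  then obtain c where c: "\<And>x. x \<in> {-r<..<r} \<Longrightarrow> Im (f (of_real x)) = c" by blast
  have "t \<in> {-r<..<r}" "0 \<in> {-r<..<r}" using t by auto
  then have "Im (f (of_real t)) = Im (f (of_real 0))" using c by metis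
  then show ?thesis using \<open>f 0 \<in> \<real>\<close> by (simp add: complex_is_Real_iff)
qed

lemma deriv_eq_on_ball:
  assumes "\<And>w. w \<in> ball z0 r \<Longrightarrow> f w = g w" "z \<in> ball (z0::complex) r"
  shows "deriv f z = deriv g z"
proof (rule deriv_cong_ev[OF _ refl])
  show "\<forall>\<^sub>F w in nhds z. f w = g w"
    using assms by (auto simp: eventually_nhds intro!: exI[of _ "ball z0 r"])
qed

lemma eq_of_deriv_eq:
  assumes f: "f holomorphic_on ball 0 r" and g: "g holomorphic_on ball 0 r"
    and "\<And>w. w \<in> ball 0 r \<Longrightarrow> deriv f w = deriv g w" "f 0 = g 0" "z \<in> ball (0::complex) r"
  shows "f z = g z"
proof -
  have "r > 0" using \<open>z \<in> ball 0 r\<close> by (metis ball_eq_empty empty_iff not_le)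
  have "((\<lambda>z. f z - g z) has_field_derivative 0) (at w within ball 0 r)" if "w \<in> ball 0 r" for w
    using assms(3)[OF that] holomorphic_derivI[OF f _ that] holomorphic_derivI[OF g _ that]
    by (auto intro!: derivative_eq_intros)
  then obtain c where "\<And>w. w \<in> ball 0 r \<Longrightarrow> f w - g w = c"
    using has_field_derivative_zero_constant[of "ball 0 r" "\<lambda>z. f z - g z"] by auto
  from this[of 0] this[of z] show ?thesis using assms \<open>r > 0\<close> by simp
qed

section \<open>Analytic curves and their holomorphic extensions\<close>

lemma has_vector_derivative_cart:
  fixes f :: "real \<Rightarrow> real ^ 'n"
  shows "(f has_vector_derivative f') (at t) \<longleftrightarrow>
    (\<forall>j. ((\<lambda>s. f s $ j) has_vector_derivative f' $ j) (at t))"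
proof
  assume "(f has_vector_derivative f') (at t)"
  then show "\<forall>j. ((\<lambda>s. f s $ j) has_vector_derivative f' $ j) (at t)"
    using bounded_linear.has_vector_derivative[OF bounded_linear_vec_nth] by blast
next
  assume "\<forall>j. ((\<lambda>s. f s $ j) has_vector_derivative f' $ j) (at t)"
  then show "(f has_vector_derivative f') (at t)"
    unfolding has_vector_derivative_def
    by (subst has_derivative_componentwise_within)
       (auto simp: Basis_vec_def inner_axis)
qed

lemma velocity_eq:
  "(f has_vector_derivative f') (at t) \<Longrightarrow> velocity f t = f'"
  unfolding velocity_def by (rule vector_derivative_at)

lemma velocity_cong:
  assumes "open I" "t \<in> I" "\<And>s. s \<in> I \<Longrightarrow> f s = g s"
  shows "velocity f t = velocity g t"
  unfolding velocity_def
  by (rule vector_derivative_cong_eq) (use assms in \<open>auto simp: eventually_nhds\<close>)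

lemma curvature_vector_cong:
  assumes "open I" "t \<in> I" "\<And>s. s \<in> I \<Longrightarrow> f s = g s"
  shows "curvature_vector f t = curvature_vector g t"
proof -
  have v: "velocity f s = velocity g s" if "s \<in> I" for s
    by (rule velocity_cong[OF assms(1) that assms(3)])
  moreover have "velocity (velocity f) t = velocity (velocity g) t"
    by (rule velocity_cong[OF assms(1,2) v])
  ultimately show ?thesis using assms(2) by (simp add: curvature_vector_def)
qed

text \<open>\<open>F\<close> is real on \<open>I\<close>, so the derivative of its imaginary part
  along \<open>I\<close> is 0, which makes \<open>deriv F\<close> real there. The extension thereby
  also supplies the differentiability of \<open>f\<close>.\<close>

lemma real_extension_derivative:
  assumes F: "F holomorphic_on \<Omega>" "open \<Omega>" and "open I"
    and ext: "\<And>t. t \<in> I \<Longrightarrow> of_real t \<in> \<Omega> \<and> F (of_real t) = of_real (f t)" and t: "t \<in> I"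
  shows "(f has_vector_derivative velocity f t) (at t)"
    and "deriv F (of_real t) = of_real (velocity f t)"
proof -
  have "(F has_field_derivative deriv F (of_real t)) (at (of_real t))"
    using ext[OF t] by (intro holomorphic_derivI[OF F]) auto
  then have "((\<lambda>s. F (of_real s)) has_vector_derivative deriv F (of_real t)) (at t)"
    by (rule has_vector_derivative_real_field)
  then have D: "((\<lambda>s. of_real (f s)) has_vector_derivative deriv F (of_real t)) (at t)"
    by (rule has_vector_derivative_transform_within_open[OF _ \<open>open I\<close> t]) (use ext in auto)
  have "((\<lambda>s. Re (of_real (f s))) has_vector_derivative Re (deriv F (of_real t))) (at t)"
    by (rule bounded_linear.has_vector_derivative[OF bounded_linear_Re D])
  then have R: "(f has_vector_derivative Re (deriv F (of_real t))) (at t)" by simp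
  have "((\<lambda>s. Im (of_real (f s))) has_vector_derivative Im (deriv F (of_real t))) (at t)"
    by (rule bounded_linear.has_vector_derivative[OF bounded_linear_Im D])
  moreover have "((\<lambda>s. Im (of_real (f s))) has_vector_derivative 0) (at t)"
    by simp
  ultimately have "Im (deriv F (of_real t)) = 0"
    using vector_derivative_unique_at by blast
  then show "deriv F (of_real t) = of_real (velocity f t)"
    using velocity_eq[OF R] by (simp add: complex_eq_iff)
  show "(f has_vector_derivative velocity f t) (at t)"
    using R velocity_eq[OF R] by simp
qed

text \<open>The second conclusion has the form of the hypothesis, so the lemma can be iterated;
  applied twice it provides the second derivatives that enter the curvature vector.\<close>

lemma holomorphic_extension_deriv:
  assumes G: "holomorphic_extension \<Omega> I g G" and "open \<Omega>" "open I" "of_real ` I \<subseteq> \<Omega>"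
  shows "\<And>t. t \<in> I \<Longrightarrow> (g has_vector_derivative velocity g t) (at t)"
    and "holomorphic_extension \<Omega> I (velocity g) (\<lambda>z. \<chi> j. deriv (\<lambda>\<zeta>. G \<zeta> $ j) z)"
proof -
  have H: "((\<lambda>s. g s $ j) has_vector_derivative velocity (\<lambda>s. g s $ j) t) (at t)"
    "deriv (\<lambda>\<zeta>. G \<zeta> $ j) (of_real t) = of_real (velocity (\<lambda>s. g s $ j) t)" if "t \<in> I" for t j
    using real_extension_derivative[of "\<lambda>\<zeta>. G \<zeta> $ j" \<Omega> I "\<lambda>s. g s $ j" t] assms that
    by (auto simp: holomorphic_extension_def)
  have V: "(g has_vector_derivative (\<chi> j. velocity (\<lambda>s. g s $ j) t)) (at t)" if "t \<in> I" for t
    using H(1)[OF that] by (simp add: has_vector_derivative_cart)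
  then show "(g has_vector_derivative velocity g t) (at t)" if "t \<in> I" for t
    using that velocity_eq by metis
  have "velocity g t $ j = velocity (\<lambda>s. g s $ j) t" if "t \<in> I" for t j
    using velocity_eq[OF V[OF that]] by simp
  then show "holomorphic_extension \<Omega> I (velocity g) (\<lambda>z. \<chi> j. deriv (\<lambda>\<zeta>. G \<zeta> $ j) z)"
    using H(2) assms by (auto simp: holomorphic_extension_def intro!: holomorphic_deriv)
qed

lemma holomorphic_sums_at_real:
  assumes F: "F holomorphic_on \<Omega>" and r: "ball (of_real t) r \<subseteq> \<Omega>" and "\<bar>s - t\<bar> < r"
  shows "(\<lambda>k. (deriv ^^ k) F (of_real t) / fact k * of_real ((s - t) ^ k)) sums F (of_real s)"
proof -
  have "(\<lambda>k. (deriv ^^ k) F (of_real t) / fact k * (of_real s - of_real t) ^ k) sums F (of_real s)"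
  proof (rule holomorphic_power_series[of F "of_real t" r])
    show "complex_of_real s \<in> ball (of_real t) r"
      using assms by (simp add: dist_real_def abs_minus_commute)
  qed (use F r holomorphic_on_subset in auto)
  then show ?thesis by simp
qed

lemma real_analytic_holomorphic:
  assumes "F holomorphic_on \<Omega>" "open \<Omega>" "of_real ` I \<subseteq> \<Omega>"
  shows "real_analytic_on (\<lambda>t. F (of_real t)) I"
  unfolding real_analytic_on_def
proof
  fix t assume "t \<in> I"
  then obtain r where r: "r > 0" "ball (of_real t) r \<subseteq> \<Omega>"
    using assms(2,3) openE by blast
  have "(\<lambda>k. (s - t) ^ k *\<^sub>R ((deriv ^^ k) F (of_real t) / fact k)) sums F (of_real s)"
    if "\<bar>s - t\<bar> < r" for s
    using holomorphic_sums_at_real[OF assms(1) r(2) that] by (simp add: scaleR_conv_of_real mult.commute)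
  then show "\<exists>r>0. \<exists>a. \<forall>s. \<bar>s - t\<bar> < r \<longrightarrow> (\<lambda>k. (s - t) ^ k *\<^sub>R a k) sums F (of_real s)"
    using r(1)
    by (intro exI[of _ r] conjI exI[of _ "\<lambda>k. (deriv ^^ k) F (of_real t) / fact k"]) auto
qed

lemma Re_times_of_real: "Re (z * of_real x) = x * Re z"
  by simp

text \<open>The coefficients are the real parts of the Taylor coefficients of the extension, which
  is legitimate because the powers of \<open>s - t\<close> are real.\<close>

lemma holomorphic_extension_imp_real_analytic:
  assumes G: "holomorphic_extension \<Omega> I g G" and "open \<Omega>" "open I" "of_real ` I \<subseteq> \<Omega>"
  shows "real_analytic_on g I"
  unfolding real_analytic_on_def
proof
  fix t assume t: "t \<in> I"
  then obtain r1 where r1: "r1 > 0" "ball (complex_of_real t) r1 \<subseteq> \<Omega>"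
    using assms openE by blast
  obtain r2 where r2: "r2 > 0" "ball t r2 \<subseteq> I"
    using t assms openE by blast
  define r where "r = min r1 r2"
  define a where "a k = (\<chi> j. Re ((deriv ^^ k) (\<lambda>\<zeta>. G \<zeta> $ j) (of_real t) / fact k))" for k
  have "(\<lambda>k. (s - t) ^ k *\<^sub>R a k) sums g s" if s: "\<bar>s - t\<bar> < r" for s
  proof -
    have "s \<in> I" using r2 s by (auto simp: r_def dist_real_def subset_iff abs_minus_commute)
    have "(\<lambda>k. ((s - t) ^ k *\<^sub>R a k) $ j) sums (g s $ j)" for j
    proof -
      have "(\<lambda>k. (deriv ^^ k) (\<lambda>\<zeta>. G \<zeta> $ j) (of_real t) / fact k * of_real ((s - t) ^ k))
          sums (G (of_real s) $ j)"
        using G r1(2) s by (intro holomorphic_sums_at_real) (auto simp: holomorphic_extension_def r_def)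
      from sums_Re[OF this] have "(\<lambda>k. (s - t) ^ k *
          Re ((deriv ^^ k) (\<lambda>\<zeta>. G \<zeta> $ j) (of_real t) / fact k)) sums Re (G (of_real s) $ j)"
        by (simp only: Re_times_of_real)
      then show ?thesis
        using G \<open>s \<in> I\<close> by (simp add: a_def holomorphic_extension_def)
    qed
    then show ?thesis
      unfolding sums_def by (intro vec_tendstoI) simp
  qed
  moreover have "r > 0" using r1 r2 by (simp add: r_def)
  ultimately show "\<exists>r>0. \<exists>a. \<forall>s. \<bar>s - t\<bar> < r \<longrightarrow> (\<lambda>k. (s - t) ^ k *\<^sub>R a k) sums g s"
    by blast
qed

text \<open>The same power series is read with a complex argument. It serves for the change of
  parameter, which is only known to be real analytic, whereas curves and normals come with their
  extensions.\<close>

lemma real_analytic_holomorphic_extension: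
  fixes f :: "real \<Rightarrow> real"
  assumes "real_analytic_on f I" "0 \<in> I"
  obtains r F where "r > 0" "F holomorphic_on ball 0 r"
    "\<And>t. \<bar>t\<bar> < r \<Longrightarrow> F (of_real t) = complex_of_real (f t)"
proof -
  obtain r a where r: "r > 0" and a: "\<And>s. \<bar>s\<bar> < r \<Longrightarrow> (\<lambda>k. s ^ k *\<^sub>R a k) sums f s"
    using assms by (force simp: real_analytic_on_def)
  define F where "F z = (\<Sum>k. complex_of_real (a k) * z ^ k)" for z
  have S: "(\<lambda>k. complex_of_real (a k) * of_real t ^ k) sums of_real (f t)" if "\<bar>t\<bar> < r" for t
    using sums_of_real[OF a[OF that], where 'a = complex] by (simp add: mult.commute)
  have "F holomorphic_on ball 0 r"
  proof (rule power_series_holomorphic)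
    fix w :: complex assume w: "w \<in> ball 0 r"
    \<comment> \<open>A real point with |w| < t < r: convergence at t, known from the real series,
      gives convergence at w.\<close>
    define t where "t = (norm w + r) / 2"
    have wr: "norm w < r" using w by simp
    then have t1: "norm w < t" unfolding t_def by simp
    have "t < r" unfolding t_def using wr by simp
    moreover have "0 < t" using t1 norm_ge_zero[of w] by (rule le_less_trans[rotated])
    ultimately have t2: "\<bar>t\<bar> < r" by simp
    then have "norm w < norm (complex_of_real t)" using t1 \<open>0 < t\<close> by simp
    from powser_inside[OF sums_summable[OF S[OF t2]] this]
    have "summable (\<lambda>k. complex_of_real (a k) * w ^ k)" .
    then show "(\<lambda>k. complex_of_real (a k) * (w - 0) ^ k) sums F w"
      unfolding F_def diff_zero by (rule summable_sums)
  qed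
  moreover have "F (of_real t) = of_real (f t)" if "\<bar>t\<bar> < r" for t
    unfolding F_def using sums_unique[OF S[OF that]] by (rule sym)
  ultimately show ?thesis using that r by blast
qed

section \<open>Surfaces as real parts of holomorphic maps\<close>

lemma complex_cross_of_real:
  assumes "\<And>j. a $ j = of_real (x $ j)" "\<And>j. b $ j = of_real (y $ j)"
  shows "complex_cross a b $ j = of_real (cross3 x y $ j)"
  using exhaust_3[of j] assms by (auto simp: complex_cross_def cross3_def)

text \<open>On a disc the integrand has a primitive and the segment from 0 to \<open>w\<close> is an
  admissible path, so the contour integral becomes a function \<open>W\<close> that is described by
  its derivative on the real axis alone.\<close>

lemma bjoerling_local:
  assumes X: "is_bjoerling \<Omega> I c X" and "open \<Omega>" "open I" "0 \<in> I" and I: "of_real ` I \<subseteq> \<Omega>"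
  obtains n C W r where "principal_normal_field I c n" "holomorphic_extension \<Omega> I c C"
    "r > 0" "ball 0 r \<subseteq> \<Omega>" "{-r<..<r} \<subseteq> I"
    "\<And>j. W j holomorphic_on ball 0 r" "\<And>j. W j 0 = 0"
    "\<And>j t. \<bar>t\<bar> < r \<Longrightarrow> deriv (W j) (of_real t) = of_real (cross3 (n t) (velocity c t) $ j)"
    "\<And>w j. w \<in> ball 0 r \<Longrightarrow> X w $ j = Re (C w $ j - \<i> * W j w)"
proof -
  obtain n C N where n: "principal_normal_field I c n" and C: "holomorphic_extension \<Omega> I c C"
    and N: "holomorphic_extension \<Omega> I n N"
    and X': "\<And>w g k. \<lbrakk>w \<in> \<Omega>; valid_path g; path_image g \<subseteq> \<Omega>; pathstart g = 0; pathfinish g = w\<rbrakk> \<Longrightarrow>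
       X w $ k = Re (C w $ k - \<i> * contour_integral g
          (\<lambda>z. complex_cross (N z) (\<chi> j. deriv (\<lambda>\<zeta>. C \<zeta> $ j) z) $ k))"
    using X unfolding is_bjoerling_def by blast
  obtain r1 where r1: "r1 > 0" "ball (0::complex) r1 \<subseteq> \<Omega>"
    using \<open>0 \<in> I\<close> I \<open>open \<Omega>\<close> openE[of \<Omega> 0] by (metis image_subset_iff of_real_0)
  obtain r2 where r2: "r2 > 0" "ball (0::real) r2 \<subseteq> I"
    using \<open>0 \<in> I\<close> \<open>open I\<close> openE by blast
  define r where "r = min r1 r2"
  have r: "r > 0" "ball (0::complex) r \<subseteq> \<Omega>" using r1 r2 by (auto simp: r_def)
  have rI: "{-r<..<r} \<subseteq> I" using r2 by (auto simp: r_def subset_iff dist_real_def)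
  define V where "V z = complex_cross (N z) (\<chi> j. deriv (\<lambda>\<zeta>. C \<zeta> $ j) z)" for z
  have V: "(\<lambda>z. V z $ j) holomorphic_on ball 0 r" for j
  proof -
    have "(\<lambda>z. V z $ j) holomorphic_on \<Omega>"
      using exhaust_3[of j] C N \<open>open \<Omega>\<close> unfolding V_def complex_cross_def holomorphic_extension_def
      by (auto intro!: holomorphic_intros)
    then show ?thesis using r holomorphic_on_subset by blast
  qed
  have "\<exists>h. \<forall>z\<in>ball 0 r. (h has_field_derivative V z $ j) (at z within ball 0 r)" for j
    using holomorphic_convex_primitive'[OF convex_ball open_ball V[of j]] by metis
  then obtain h where h:
    "\<And>j z. z \<in> ball 0 r \<Longrightarrow> (h j has_field_derivative V z $ j) (at z within ball 0 r)"
    by metis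
  define W where "W j z = h j z - h j 0" for j z
  have W: "(W j has_field_derivative V z $ j) (at z)" if "z \<in> ball 0 r" for j z
  proof -
    have "(h j has_field_derivative V z $ j) (at z)"
      using h[OF that, of j] that by (simp add: at_within_open[OF _ open_ball])
    from DERIV_diff[OF this DERIV_const[of "h j 0"]] show ?thesis by (simp add: W_def [abs_def])
  qed
  show ?thesis
  proof (rule that[OF n C r rI])
    show "W j holomorphic_on ball 0 r" for j
      using W by (intro holomorphic_onI) (meson field_differentiable_at_within field_differentiable_def)
    show "W j 0 = 0" for j by (simp add: W_def)
  next
    fix j t assume t: "\<bar>t\<bar> < r"
    then have "t \<in> {-r<..<r}" by auto
    then have "t \<in> I" using rI by blast
    have "deriv (W j) (of_real t) = V (of_real t) $ j"
      using t by (intro DERIV_imp_deriv W) auto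
    also have "\<dots> = of_real (cross3 (n t) (velocity c t) $ j)"
      unfolding V_def
    proof (rule complex_cross_of_real)
      show "N (of_real t) $ k = of_real (n t $ k)" for k
        using N \<open>t \<in> I\<close> by (auto simp: holomorphic_extension_def)
      show "(\<chi> j. deriv (\<lambda>\<zeta>. C \<zeta> $ j) (of_real t)) $ k = of_real (velocity c t $ k)" for k
        using holomorphic_extension_deriv(2)[OF C \<open>open \<Omega>\<close> \<open>open I\<close> I] \<open>t \<in> I\<close>
        by (auto simp: holomorphic_extension_def)
    qed
    finally show "deriv (W j) (of_real t) = of_real (cross3 (n t) (velocity c t) $ j)" .
  next
    fix w :: complex and j assume w: "w \<in> ball 0 r"
    have seg: "path_image (linepath 0 w) \<subseteq> ball 0 r"
      unfolding path_image_linepath by (rule closed_segment_subset[OF _ w convex_ball]) (use r in simp)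
    have "((\<lambda>z. V z $ j) has_contour_integral
        (W j (pathfinish (linepath 0 w)) - W j (pathstart (linepath 0 w)))) (linepath 0 w)"
      by (rule contour_integral_primitive[OF has_field_derivative_at_within[OF W] valid_path_linepath seg])
    then have "contour_integral (linepath 0 w) (\<lambda>z. V z $ j) = W j w"
      by (simp add: contour_integral_unique W_def)
    then show "X w $ j = Re (C w $ j - \<i> * W j w)"
      using X'[of w "linepath 0 w" j, OF _ valid_path_linepath] w r(2) seg unfolding V_def
      by (metis pathfinish_linepath pathstart_linepath subset_iff)
  qed
qed

text \<open>The derivative of Re F in the direction \<open>a\<close> is the real part of a F'(w);
  the cases a = 1 and a = \<i> are the two partial derivatives.\<close>

lemma partial_re_holomorphic:
  assumes S: "open S" "w \<in> S" and F: "\<And>j. F j holomorphic_on S"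
    and X: "\<And>z j. z \<in> S \<Longrightarrow> X z $ j = Re (F j z)"
  shows "partial_u X w = (\<chi> j. Re (deriv (F j) w))"
    and "partial_v X w = (\<chi> j. - Im (deriv (F j) w))"
proof -
  have D: "((\<lambda>t. X (w + a * of_real t)) has_vector_derivative (\<chi> j. Re (a * deriv (F j) w))) (at 0)" for a
    unfolding has_vector_derivative_cart
  proof
    fix j
    have "(F j has_field_derivative deriv (F j) w) (at (w + a * of_real 0))"
      using holomorphic_derivI[OF F S] by simp
    then have "((\<lambda>z. F j (w + a * z)) has_field_derivative deriv (F j) w * a) (at (of_real 0))"
      by (intro DERIV_chain2[where f = "F j"]) (auto intro!: derivative_eq_intros)
    then have "((\<lambda>t. F j (w + a * of_real t)) has_vector_derivative deriv (F j) w * a) (at 0)"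
      using has_vector_derivative_real_field[of "\<lambda>z. F j (w + a * z)" _ 0] by simp
    from bounded_linear.has_vector_derivative[OF bounded_linear_Re this]
    have R: "((\<lambda>t. Re (F j (w + a * of_real t))) has_vector_derivative Re (a * deriv (F j) w)) (at 0)"
      by (simp add: mult.commute)
    have "open ((\<lambda>t. w + a * complex_of_real t) -` S)"
      by (intro open_vimage S continuous_intros)
    then have "((\<lambda>t. X (w + a * of_real t) $ j) has_vector_derivative Re (a * deriv (F j) w)) (at 0)"
      by (rule has_vector_derivative_transform_within_open[OF R]) (use S X in auto)
    then show "((\<lambda>t. X (w + a * of_real t) $ j) has_vector_derivative
        (\<chi> j. Re (a * deriv (F j) w)) $ j) (at 0)" by simp
  qed
  show "partial_u X w = (\<chi> j. Re (deriv (F j) w))"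
    using vector_derivative_at[OF D[of 1]] by (simp add: partial_u_def)
  show "partial_v X w = (\<chi> j. - Im (deriv (F j) w))"
    using vector_derivative_at[OF D[of \<i>]] by (simp add: partial_v_def)
qed

text \<open>With X = Re F, the equations defining the adjoint say that \<open>Xs\<close> has the
  same partial derivatives as Im F. Since \<open>Xs\<close> is differentiable, its full differential
  then agrees with that of Im F, and the difference is constant on the disc.\<close>

lemma adjoint_re_holomorphic:
  assumes adj: "adjoint_surface \<Omega> X Xs" and "ball 0 r \<subseteq> \<Omega>"
    and F: "\<And>j. F j holomorphic_on ball 0 r"
    and X: "\<And>z j. z \<in> ball 0 r \<Longrightarrow> X z $ j = Re (F j z)"
  obtains d where "\<And>z j. z \<in> ball 0 r \<Longrightarrow> Xs z $ j = Im (F j z) + d $ j"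
proof -
  have "\<exists>c. \<forall>z\<in>ball 0 r. Xs z $ j - Im (F j z) = c" for j
  proof (rule has_derivative_zero_constant[OF convex_ball])
    fix w :: complex assume w: "w \<in> ball 0 r"
    then have "Xs differentiable (at w)"
      and eq: "partial_u X w = partial_v Xs w" "partial_v X w = - partial_u Xs w"
      using adj assms(2) unfolding adjoint_surface_def by blast+
    then obtain D where D: "(Xs has_derivative D) (at w)"
      by (auto simp: differentiable_def)
    have lin: "linear D" using D has_derivative_linear by blast
    have "((\<lambda>t. Xs (w + a * of_real t)) has_vector_derivative D a) (at 0)" for a
    proof -
      have "((\<lambda>t. w + a * of_real t) has_derivative (\<lambda>t. a * of_real t)) (at 0)"
        by (auto intro!: derivative_eq_intros)
      moreover have "(Xs has_derivative D) (at (w + a * of_real 0))" using D by simp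
      ultimately have "((\<lambda>t. Xs (w + a * of_real t)) has_derivative (\<lambda>t. D (a * of_real t))) (at 0)"
        by (rule has_derivative_compose)
      moreover have "D (a * of_real t) = t *\<^sub>R D a" for t
        using linear_scale[OF lin, of t a] by (simp add: scaleR_conv_of_real mult.commute)
      ultimately show ?thesis by (simp add: has_vector_derivative_def)
    qed
    from this[of 1] this[of \<i>] have "D 1 = partial_u Xs w" "D \<i> = partial_v Xs w"
      by (simp_all add: partial_u_def partial_v_def vector_derivative_at)
    then have D1: "D 1 $ j = Im (deriv (F j) w)" and Di: "D \<i> $ j = Re (deriv (F j) w)"
      using eq partial_re_holomorphic[where F = F and X = X, OF open_ball w F X]
      by (simp_all add: vec_eq_iff)
    \<comment> \<open>A real linear map on the plane is determined by its values at 1 and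
      \<i>.\<close>
    have Dh: "D h $ j = Im (deriv (F j) w * h)" for h
    proof -
      have "D h = D (Re h *\<^sub>R 1 + Im h *\<^sub>R \<i>)"
        by (rule arg_cong[of _ _ D]) (simp add: complex_eq_iff)
      also have "\<dots> = Re h *\<^sub>R D 1 + Im h *\<^sub>R D \<i>"
        using lin by (simp add: linear_add linear_scale)
      finally show ?thesis by (simp add: D1 Di)
    qed
    have "(F j has_derivative (\<lambda>h. deriv (F j) w * h)) (at w)"
      using holomorphic_derivI[OF F open_ball w] by (simp add: has_field_derivative_def)
    then have "((\<lambda>z. Im (F j z)) has_derivative (\<lambda>h. Im (deriv (F j) w * h))) (at w)"
      by (rule bounded_linear.has_derivative[OF bounded_linear_Im])
    moreover have "((\<lambda>z. Xs z $ j) has_derivative (\<lambda>h. D h $ j)) (at w)"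
      by (rule bounded_linear.has_derivative[OF bounded_linear_vec_nth D])
    ultimately have "((\<lambda>z. Xs z $ j - Im (F j z)) has_derivative
        (\<lambda>h. D h $ j - Im (deriv (F j) w * h))) (at w)"
      by (intro has_derivative_diff)
    then show "((\<lambda>z. Xs z $ j - Im (F j z)) has_derivative (\<lambda>h. 0)) (at w within ball 0 r)"
      unfolding Dh by (auto intro: has_derivative_at_withinI)
  qed
  then obtain d where "\<And>j z. z \<in> ball 0 r \<Longrightarrow> Xs z $ j - Im (F j z) = d j" by metis
  then have "\<And>z j. z \<in> ball 0 r \<Longrightarrow> Xs z $ j = Im (F j z) + (\<chi> j. d j) $ j"
    by (metis diff_add_cancel add.commute vec_lambda_beta)
  then show ?thesis using that by blast
qed

section \<open>Rotations and changes of parameter\<close>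

lemma inner_orthogonal_matrix:
  assumes "orthogonal_matrix A"
  shows "(A *v x) \<bullet> (A *v y) = x \<bullet> (y :: real ^ 'n)"
proof -
  have "orthogonal_transformation ((*v) A)"
    using assms by (simp add: orthogonal_transformation_matrix matrix_of_matrix_vector_mul)
  then show ?thesis by (simp add: orthogonal_transformation_def)
qed

lemma norm_orthogonal_matrix:
  "orthogonal_matrix A \<Longrightarrow> norm (A *v x) = norm (x :: real ^ 'n)"
  by (simp add: norm_eq_sqrt_inner inner_orthogonal_matrix)

lemma transpose_orthogonal_matrix_cancel:
  "orthogonal_matrix A \<Longrightarrow> transpose A *v (A *v x) = (x :: real ^ 'n)"
  by (simp add: matrix_vector_mul_assoc orthogonal_matrix)

lemma orthogonal_matrix_eq_0_iff:
  "orthogonal_matrix A \<Longrightarrow> A *v x = 0 \<longleftrightarrow> x = (0 :: real ^ 'n)"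
  by (metis norm_eq_zero norm_orthogonal_matrix)

lemma cross3_rotation:
  "\<lbrakk>orthogonal_matrix A; det A = 1\<rbrakk> \<Longrightarrow> cross3 (A *v x) (A *v y) = A *v cross3 x y"
  by (simp add: cross_orthogonal_matrix)

text \<open>A change of parameter multiplies the acceleration by the square of its speed and adds a
  tangential term. The projection in the curvature vector removes the latter and the division by the
  squared speed the former, so the vector is only rotated, also when the parameter runs
  backwards.\<close>

lemma rigid_reparametrization:
  fixes \<phi> :: "real \<Rightarrow> real"
  assumes A: "orthogonal_matrix A" and "open J" and \<phi>J: "\<phi> ` J \<subseteq> I"
    and k: "\<And>s. s \<in> J \<Longrightarrow> k s = A *v c (\<phi> s) + b"
    and c: "\<And>t. t \<in> I \<Longrightarrow> (c has_vector_derivative velocity c t) (at t)"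
    and \<phi>: "\<And>s. s \<in> J \<Longrightarrow> (\<phi> has_vector_derivative velocity \<phi> s) (at s)"
  shows rigid_reparametrization_velocity:
      "\<And>s. s \<in> J \<Longrightarrow> velocity k s = velocity \<phi> s *\<^sub>R (A *v velocity c (\<phi> s))"
    and rigid_reparametrization_curvature:
      "\<And>s. \<lbrakk>s \<in> J; velocity \<phi> s \<noteq> 0;
         (velocity c has_vector_derivative velocity (velocity c) (\<phi> s)) (at (\<phi> s));
         (velocity \<phi> has_vector_derivative velocity (velocity \<phi>) s) (at s)\<rbrakk> \<Longrightarrow>
         curvature_vector k s = A *v curvature_vector c (\<phi> s)"
proof -
  have comp: "((\<lambda>s. A *v f (\<phi> s)) has_vector_derivative velocity \<phi> s *\<^sub>R (A *v f')) (at s)"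
    if "s \<in> J" "(f has_vector_derivative f') (at (\<phi> s))" for f f' s
    using bounded_linear.has_vector_derivative[OF matrix_vector_mul_bounded_linear
        vector_diff_chain_at[OF \<phi>[OF that(1)] that(2)], of A]
    by (simp add: o_def matrix_vector_mult_scaleR)
  show vel: "velocity k s = velocity \<phi> s *\<^sub>R (A *v velocity c (\<phi> s))" if "s \<in> J" for s
  proof -
    have "((\<lambda>s. A *v c (\<phi> s) + b) has_vector_derivative velocity \<phi> s *\<^sub>R (A *v velocity c (\<phi> s))) (at s)"
      using comp[OF that c] \<phi>J that by (auto simp: has_vector_derivative_add_const)
    then have "(k has_vector_derivative velocity \<phi> s *\<^sub>R (A *v velocity c (\<phi> s))) (at s)"
      by (rule has_vector_derivative_transform_within_open[OF _ \<open>open J\<close> that]) (use k in auto)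
    then show ?thesis by (rule velocity_eq)
  qed
  fix s assume s: "s \<in> J" and nz: "velocity \<phi> s \<noteq> 0"
    and c2: "(velocity c has_vector_derivative velocity (velocity c) (\<phi> s)) (at (\<phi> s))"
    and \<phi>2: "(velocity \<phi> has_vector_derivative velocity (velocity \<phi>) s) (at s)"
  define x where "x = velocity c (\<phi> s)"
  define y where "y = velocity (velocity c) (\<phi> s)"
  define v where "v = velocity \<phi> s"
  define u where "u = velocity (velocity \<phi>) s"
  have "((\<lambda>s. velocity \<phi> s *\<^sub>R (A *v velocity c (\<phi> s))) has_vector_derivative
      v *\<^sub>R (v *\<^sub>R (A *v y)) + u *\<^sub>R (A *v x)) (at s)"
    using has_vector_derivative_scaleR[OF _ comp[OF s c2]] \<phi>2
    by (simp add: has_real_derivative_iff_has_vector_derivative u_def v_def x_def y_def)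
  then have "(velocity k has_vector_derivative v *\<^sub>R (v *\<^sub>R (A *v y)) + u *\<^sub>R (A *v x)) (at s)"
    by (rule has_vector_derivative_transform_within_open[OF _ \<open>open J\<close> s]) (use vel in auto)
  then have acc: "velocity (velocity k) s = v\<^sup>2 *\<^sub>R (A *v y) + u *\<^sub>R (A *v x)"
    by (simp add: velocity_eq power2_eq_square)
  show "curvature_vector k s = A *v curvature_vector c (\<phi> s)"
  proof (cases "x = 0")
    \<comment> \<open>Both sides are 0 here, by the convention that division by 0 gives 0.\<close>
    case True
    then show ?thesis by (simp add: curvature_vector_def vel[OF s] x_def Let_def)
  next
    case False
    then have p: "x \<bullet> x \<noteq> 0" by simp
    have "v \<noteq> 0" using nz by (simp add: v_def)
    have i1: "(v *\<^sub>R (A *v x)) \<bullet> (v *\<^sub>R (A *v x)) = v\<^sup>2 * (x \<bullet> x)"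
      by (simp add: inner_orthogonal_matrix[OF A] power2_eq_square)
    have i2: "(v\<^sup>2 *\<^sub>R (A *v y) + u *\<^sub>R (A *v x)) \<bullet> (v *\<^sub>R (A *v x)) =
        v ^ 3 * (y \<bullet> x) + u * v * (x \<bullet> x)"
      by (simp add: inner_add_left inner_orthogonal_matrix[OF A] power2_eq_square power3_eq_cube
          algebra_simps)
    \<comment> \<open>The summand u is the contribution of the second derivative of
      \<open>\<phi>\<close>; it cancels against the tangential part of the acceleration.\<close>
    have coeff: "(v ^ 3 * q + u * v * p) / (v\<^sup>2 * p) * v = v\<^sup>2 * (q / p) + u" if "p \<noteq> 0" for p q
      using that \<open>v \<noteq> 0\<close> by (simp add: field_simps power2_eq_square power3_eq_cube)
    have "curvature_vector k s = (1 / (v\<^sup>2 * (x \<bullet> x))) *\<^sub>R (v\<^sup>2 *\<^sub>R (A *v y) + u *\<^sub>R (A *v x) -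
        ((v ^ 3 * (y \<bullet> x) + u * v * (x \<bullet> x)) / (v\<^sup>2 * (x \<bullet> x))) *\<^sub>R (v *\<^sub>R (A *v x)))"
      unfolding curvature_vector_def acc vel[OF s] Let_def x_def[symmetric] v_def[symmetric] i1 i2 ..
    also have "v\<^sup>2 *\<^sub>R (A *v y) + u *\<^sub>R (A *v x) -
        ((v ^ 3 * (y \<bullet> x) + u * v * (x \<bullet> x)) / (v\<^sup>2 * (x \<bullet> x))) *\<^sub>R (v *\<^sub>R (A *v x)) =
        v\<^sup>2 *\<^sub>R (A *v y - ((y \<bullet> x) / (x \<bullet> x)) *\<^sub>R (A *v x))"
      unfolding scaleR_scaleR coeff[OF p] by (simp add: algebra_simps)
    finally show ?thesis
      using \<open>v \<noteq> 0\<close>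
      by (simp add: curvature_vector_def Let_def x_def y_def matrix_vector_mult_scaleR matrix_vector_mult_diff_distrib)
  qed
qed

section \<open>Self-CPG pairs\<close>

text \<open>The bound on \<open>a\<close> keeps \<open>a * z\<close> in the disc. The constants used
  are -1, \<i>, \<open>\<omega>\<close> and \<open>\<i> * \<omega>\<close>, all of modulus 1, so
  symmetries never cost any radius.\<close>

lemma has_field_derivative_mult_arg:
  assumes f: "f holomorphic_on ball 0 r" and "norm a \<le> 1" and "z \<in> ball (0::complex) r"
  shows "((\<lambda>z. f (a * z)) has_field_derivative a * deriv f (a * z)) (at z)"
proof -
  have "norm (a * z) \<le> norm z" using assms(2) by (simp add: norm_mult mult_left_le_one_le)
  then have "a * z \<in> ball 0 r" using assms(3) by simp
  then have "(f has_field_derivative deriv f (a * z)) (at (a * z))"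
    by (intro holomorphic_derivI[OF f]) auto
  moreover have "((\<lambda>z. a * z) has_field_derivative a) (at z)"
    by (auto intro!: derivative_eq_intros)
  ultimately have "((\<lambda>z. f (a * z)) has_field_derivative deriv f (a * z) * a) (at z)"
    by (rule DERIV_chain2)
  then show ?thesis by (simp only: mult.commute)
qed

lemma holomorphic_on_mult_arg:
  assumes "f holomorphic_on ball 0 r" "norm a \<le> 1"
  shows "(\<lambda>z. f (a * z)) holomorphic_on ball (0::complex) r"
proof (rule holomorphic_onI)
  fix z :: complex assume "z \<in> ball 0 r"
  from has_field_derivative_mult_arg[OF assms this]
  show "(\<lambda>z. f (a * z)) field_differentiable at z within ball 0 r"
    by (meson field_differentiable_at_within field_differentiable_def)
qed

lemma deriv_mult_arg:
  assumes "f holomorphic_on ball 0 r" "norm a \<le> 1" "z \<in> ball (0::complex) r"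
  shows "deriv (\<lambda>z. f (a * z)) z = a * deriv f (a * z)"
  by (rule DERIV_imp_deriv[OF has_field_derivative_mult_arg[OF assms]])

lemma deriv_real_on_reals:
  assumes "f holomorphic_on ball 0 r" "\<And>t. \<bar>t\<bar> < r \<Longrightarrow> f (of_real t) \<in> \<real>" "\<bar>t\<bar> < r"
  shows "deriv f (complex_of_real t) \<in> \<real>"
proof -
  have "deriv f (of_real t) = of_real (velocity (\<lambda>s. Re (f (of_real s))) t)"
  proof (rule real_extension_derivative(2)[OF assms(1), of "{-r<..<r}"])
    fix s assume "s \<in> {-r<..<r}"
    then show "complex_of_real s \<in> ball 0 r \<and> f (of_real s) = of_real (Re (f (of_real s)))"
      using assms(2)[of s] by (auto simp: of_real_Re)
  qed (use assms(3) in auto)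
  then show ?thesis by simp
qed

text \<open>The equation between derivatives says that \<open>(A(z), B(z), -B(iz))\<close> is isotropic.\<close>

definition cpg_pair :: "real \<Rightarrow> (complex \<Rightarrow> complex) \<Rightarrow> (complex \<Rightarrow> complex) \<Rightarrow> bool" where
  "cpg_pair r A B \<longleftrightarrow> A holomorphic_on ball 0 r \<and> B holomorphic_on ball 0 r \<and>
     (\<forall>z\<in>ball 0 r. A (cnj z) = cnj (A z) \<and> B (cnj z) = cnj (B z) \<and>
        A (\<i> * z) = - A z \<and> B (- z) = - B z \<and>
        (deriv A z)\<^sup>2 + (deriv B z)\<^sup>2 = (deriv B (\<i> * z))\<^sup>2) \<and>
     deriv B 0 \<noteq> 0 \<and> Re (deriv (deriv A) 0) > 0"

lemma cpg_pair_mono: "\<lbrakk>cpg_pair r A B; s \<le> r\<rbrakk> \<Longrightarrow> cpg_pair s A B"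
  by (auto simp: cpg_pair_def intro: holomorphic_on_subset)

text \<open>\<open>deriv B\<close> makes the curve regular, and at the rotated point
  \<open>\<i> * z\<close> it is the denominator of the normal field. The disc is invariant under the
  rotation, so one radius serves both purposes.\<close>

lemma cpg_pair_nonvanishing:
  assumes "cpg_pair r A B" "r > 0"
  obtains s where "0 < s" "s \<le> r" "cpg_pair s A B" "\<And>z. z \<in> ball 0 s \<Longrightarrow> deriv B z \<noteq> 0"
proof -
  have "deriv B holomorphic_on ball 0 r" "deriv B 0 \<noteq> 0"
    using assms by (auto simp: cpg_pair_def intro!: holomorphic_deriv)
  then have "isCont (deriv B) 0"
    using \<open>r > 0\<close> holomorphic_on_imp_continuous_on[of "deriv B" "ball 0 r"]
    by (simp add: continuous_on_eq_continuous_at)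
  then obtain e where e: "e > 0" "\<And>z. dist 0 z < e \<Longrightarrow> deriv B z \<noteq> 0"
    using continuous_at_avoid \<open>deriv B 0 \<noteq> 0\<close> by blast
  show ?thesis
    by (rule that[of "min e r"]) (use e \<open>r > 0\<close> cpg_pair_mono[OF assms(1)] in auto)
qed

text \<open>\<open>B\<close> is odd and real on the real axis, hence imaginary on the imaginary
  axis, which makes its derivative real there. Differentiating A(iz) = -A(z) at 0 gives (i + 1)
  A'(0) = 0, and since B' is even, B''(0) = 0.\<close>

lemma cpg_pair_derivs:
  assumes P: "cpg_pair r A B"
  shows cpg_pair_deriv_real: "\<And>t. \<bar>t\<bar> < r \<Longrightarrow> deriv A (of_real t) \<in> \<real>"
      "\<And>t. \<bar>t\<bar> < r \<Longrightarrow> deriv B (of_real t) \<in> \<real>"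
      "\<And>t. \<bar>t\<bar> < r \<Longrightarrow> deriv B (\<i> * of_real t) \<in> \<real>"
    and cpg_pair_deriv_even: "\<And>z. z \<in> ball 0 r \<Longrightarrow> deriv B (- z) = deriv B z"
    and cpg_pair_deriv_0: "r > 0 \<Longrightarrow> deriv A 0 = 0" "r > 0 \<Longrightarrow> deriv (deriv B) 0 = 0"
proof -
  note D = has_field_derivative_mult_arg
  have A: "A holomorphic_on ball 0 r" and B: "B holomorphic_on ball 0 r"
    and sym: "\<And>z. z \<in> ball 0 r \<Longrightarrow> A (cnj z) = cnj (A z)"
      "\<And>z. z \<in> ball 0 r \<Longrightarrow> B (cnj z) = cnj (B z)"
      "\<And>z. z \<in> ball 0 r \<Longrightarrow> A (\<i> * z) = - A z"
      "\<And>z. z \<in> ball 0 r \<Longrightarrow> B (- z) = - B z"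
    using P by (auto simp: cpg_pair_def)
  show "deriv A (of_real t) \<in> \<real>" if "\<bar>t\<bar> < r" for t
    by (rule deriv_real_on_reals[OF A _ that])
       (use sym(1)[of "of_real _"] in \<open>auto simp: Reals_cnj_iff\<close>)
  show "deriv B (of_real t) \<in> \<real>" if "\<bar>t\<bar> < r" for t
    by (rule deriv_real_on_reals[OF B _ that])
       (use sym(2)[of "of_real _"] in \<open>auto simp: Reals_cnj_iff\<close>)
  show "deriv B (\<i> * of_real t) \<in> \<real>" if t: "\<bar>t\<bar> < r" for t
  proof -
    \<comment> \<open>The factor \<open>- \<i>\<close> makes \<open>f\<close> real on the real axis
      and cancels the \<i> of the chain rule, so that its derivative is exactly B'(iz).\<close>
    define f where "f z = - \<i> * B (\<i> * z)" for z
    have f': "(f has_field_derivative deriv B (\<i> * z)) (at z)" if "z \<in> ball 0 r" for z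
      using DERIV_cmult[OF D[OF B _ that, of \<i>], of "- \<i>"] by (simp add: f_def [abs_def])
    have "f holomorphic_on ball 0 r"
      using f' by (meson field_differentiable_at_within field_differentiable_def holomorphic_onI)
    moreover have "f (of_real s) \<in> \<real>" if "\<bar>s\<bar> < r" for s
    proof -
      have "B (cnj (\<i> * of_real s)) = cnj (B (\<i> * of_real s))"
        using that by (intro sym(2)) (simp add: norm_mult)
      moreover have "B (- (\<i> * of_real s)) = - B (\<i> * of_real s)"
        using that by (intro sym(4)) (simp add: norm_mult)
      ultimately have "cnj (B (\<i> * of_real s)) = - B (\<i> * of_real s)" by simp
      then show ?thesis by (simp add: f_def Reals_cnj_iff)
    qed
    ultimately have "deriv f (of_real t) \<in> \<real>" using t deriv_real_on_reals by blast
    moreover have "deriv f (of_real t) = deriv B (\<i> * of_real t)"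
      using t by (intro DERIV_imp_deriv f') simp
    ultimately show ?thesis by simp
  qed
  show even: "deriv B (- z) = deriv B z" if "z \<in> ball 0 r" for z
  proof -
    have "deriv (\<lambda>z. B (- 1 * z)) z = deriv (\<lambda>z. - B z) z"
      by (rule deriv_eq_on_ball[OF _ that]) (use sym(4) in auto)
    moreover have "deriv (\<lambda>z. B (- 1 * z)) z = - 1 * deriv B (- 1 * z)"
      using that by (intro DERIV_imp_deriv D[OF B]) auto
    moreover have "deriv (\<lambda>z. - B z) z = - deriv B z"
      using that by (intro DERIV_imp_deriv DERIV_minus holomorphic_derivI[OF B]) auto
    ultimately show ?thesis by simp
  qed
  assume "r > 0"
  then have 0: "0 \<in> ball (0::complex) r" by simp
  have "deriv (\<lambda>z. A (\<i> * z)) 0 = deriv (\<lambda>z. - A z) 0"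
    by (rule deriv_eq_on_ball[OF _ 0]) (use sym(3) in auto)
  moreover have "deriv (\<lambda>z. A (\<i> * z)) 0 = \<i> * deriv A (\<i> * 0)"
    using 0 by (intro DERIV_imp_deriv D[OF A]) auto
  moreover have "deriv (\<lambda>z. - A z) 0 = - deriv A 0"
    using 0 by (intro DERIV_imp_deriv DERIV_minus holomorphic_derivI[OF A]) auto
  ultimately have "\<i> * deriv A 0 = - deriv A 0" by simp
  then have "(\<i> + 1) * deriv A 0 = 0" by (simp add: distrib_right)
  moreover have "\<i> + 1 \<noteq> 0" by (simp add: complex_eq_iff)
  ultimately show "deriv A 0 = 0" by simp
  have B': "deriv B holomorphic_on ball 0 r" using B by (intro holomorphic_deriv) auto
  have "deriv (\<lambda>z. deriv B (- 1 * z)) 0 = deriv (deriv B) 0"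
    by (rule deriv_eq_on_ball[OF _ 0]) (use even in auto)
  moreover have "deriv (\<lambda>z. deriv B (- 1 * z)) 0 = - 1 * deriv (deriv B) (- 1 * 0)"
    using 0 by (intro DERIV_imp_deriv D[OF B']) auto
  ultimately show "deriv (deriv B) 0 = 0" by simp
qed

section \<open>The eighth turn of the parameter\<close>

definition \<omega> :: complex where
  "\<omega> = Complex (1 / sqrt 2) (1 / sqrt 2)"

lemma omega: "\<omega> * \<omega> = \<i>" "norm \<omega> = 1" "cnj \<omega> = - \<i> * \<omega>"
  "complex_of_real (sqrt 2) * \<omega> = 1 + \<i>"
  by (simp_all add: \<omega>_def complex_eq_iff cmod_def power_divide)

text \<open>The new pair gives the null curve \<open>-i R F(\<omega>z)\<close> if the old one gives \<open>F\<close>.\<close>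

lemma cpg_pair_adjoint:
  assumes P: "cpg_pair r A B" and "r > 0"
  shows "cpg_pair r (\<lambda>z. - \<i> * A (\<omega> * z)) (\<lambda>z. - \<i> / of_real (sqrt 2) * (B (\<omega> * z) + B (\<i> * \<omega> * z)))"
    (is "cpg_pair r ?A ?B")
proof -
  have A: "A holomorphic_on ball 0 r" and B: "B holomorphic_on ball 0 r"
    and sym: "\<And>z. z \<in> ball 0 r \<Longrightarrow> A (cnj z) = cnj (A z)"
      "\<And>z. z \<in> ball 0 r \<Longrightarrow> B (cnj z) = cnj (B z)"
      "\<And>z. z \<in> ball 0 r \<Longrightarrow> A (\<i> * z) = - A z"
      "\<And>z. z \<in> ball 0 r \<Longrightarrow> B (- z) = - B z"
    and null: "\<And>z. z \<in> ball 0 r \<Longrightarrow> (deriv A z)\<^sup>2 + (deriv B z)\<^sup>2 = (deriv B (\<i> * z))\<^sup>2"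
    and nz: "deriv B 0 \<noteq> 0" "Re (deriv (deriv A) 0) > 0"
    using P by (auto simp: cpg_pair_def)
  let ?q = "complex_of_real (sqrt 2)"
  have q: "?q * ?q = 2" by (metis of_real_mult of_real_numeral real_sqrt_mult_self abs_numeral)
  have q0: "?q \<noteq> 0" by simp
  have in_ball: "\<omega> * z \<in> ball 0 r" "\<i> * z \<in> ball 0 r" "cnj z \<in> ball 0 r" "- z \<in> ball 0 r"
    if "z \<in> ball 0 r" for z
    using that by (simp_all add: norm_mult omega)
  note D = has_field_derivative_mult_arg
  have A': "(?A has_field_derivative - \<i> * (\<omega> * deriv A (\<omega> * z))) (at z)"
    if "z \<in> ball 0 r" for z
    using that by (intro DERIV_cmult D[OF A]) (auto simp: omega)
  have B': "(?B has_field_derivative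
      - \<i> / ?q * (\<omega> * deriv B (\<omega> * z) + \<i> * \<omega> * deriv B (\<i> * \<omega> * z))) (at z)"
    if "z \<in> ball 0 r" for z
    using that by (intro DERIV_cmult DERIV_add D[OF B]) (auto simp: omega norm_mult)
  have dA: "deriv ?A z = - \<i> * \<omega> * deriv A (\<omega> * z)" if "z \<in> ball 0 r" for z
    using DERIV_imp_deriv[OF A'[OF that]] by simp
  have dB: "deriv ?B z = - \<i> * \<omega> / ?q * (deriv B (\<omega> * z) + \<i> * deriv B (\<i> * (\<omega> * z)))"
    if "z \<in> ball 0 r" for z
    using DERIV_imp_deriv[OF B'[OF that]] by (simp add: algebra_simps)
  have "?A holomorphic_on ball 0 r" "?B holomorphic_on ball 0 r"
    using A' B' by (meson field_differentiable_at_within field_differentiable_def holomorphic_onI)+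
  moreover have "?A (cnj z) = cnj (?A z) \<and> ?B (cnj z) = cnj (?B z) \<and>
        ?A (\<i> * z) = - ?A z \<and> ?B (- z) = - ?B z \<and>
        (deriv ?A z)\<^sup>2 + (deriv ?B z)\<^sup>2 = (deriv ?B (\<i> * z))\<^sup>2" if z: "z \<in> ball 0 r" for z
  proof (intro conjI)
    define u where "u = \<omega> * z"
    have u: "u \<in> ball 0 r" using in_ball z by (simp add: u_def)
    \<comment> \<open>In terms of u, conjugating z is the reflection of u in the bisector, u |-> i
      cnj u. The reality of the new pair therefore combines the reality of the old one with its
      behaviour under the quarter turn.\<close>
    have wc: "\<omega> * cnj z = \<i> * cnj u"
      by (simp add: u_def omega(3) mult.assoc)
    show "?A (cnj z) = cnj (?A z)"
      unfolding wc u_def[symmetric] using sym(1)[OF u] sym(3)[OF in_ball(3)[OF u]] by simp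
    have Biwc: "B (\<i> * \<omega> * cnj z) = - cnj (B u)"
      using sym(4)[OF in_ball(3)[OF u]] sym(2)[OF u] by (simp add: mult.assoc wc)
    have Bwc: "B (\<omega> * cnj z) = - cnj (B (\<i> * u))"
    proof -
      have "B (\<i> * cnj u) = B (- cnj (\<i> * u))" by simp
      also have "\<dots> = - cnj (B (\<i> * u))"
        using sym(4)[OF in_ball(3)[OF in_ball(2)[OF u]]] sym(2)[OF in_ball(2)[OF u]] by simp
      finally show ?thesis by (simp add: wc)
    qed
    show "?B (cnj z) = cnj (?B z)"
      unfolding Biwc Bwc by (simp add: u_def mult.assoc algebra_simps)
    show "?A (\<i> * z) = - ?A z"
      using sym(3)[OF u] by (simp add: u_def mult.left_commute)
    show "?B (- z) = - ?B z"
      using sym(4)[OF u] sym(4)[OF in_ball(2)[OF u]] by (simp add: u_def mult.assoc algebra_simps)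
    have iu: "\<omega> * (\<i> * z) = \<i> * u" "\<i> * (\<omega> * (\<i> * z)) = - u"
      by (simp_all add: u_def mult.left_commute)
    define a b1 b2 where "a = deriv A u" and "b1 = deriv B u" and "b2 = deriv B (\<i> * u)"
    have n: "a\<^sup>2 = b2\<^sup>2 - b1\<^sup>2" using null[OF u] by (simp add: a_def b1_def b2_def algebra_simps)
    have e1: "deriv ?A z = - \<i> * \<omega> * a" "deriv ?B z = - \<i> * \<omega> / ?q * (b1 + \<i> * b2)"
      unfolding dA[OF z] dB[OF z] by (simp_all add: a_def b1_def b2_def u_def)
    have e2: "deriv ?B (\<i> * z) = - \<i> * \<omega> / ?q * (b2 + \<i> * b1)"
      unfolding dB[OF in_ball(2)[OF z]] iu using cpg_pair_deriv_even[OF P u]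
      by (simp add: b1_def b2_def)
    have "\<omega>\<^sup>2 = \<i>" "?q\<^sup>2 = 2" using omega(1) q by (simp_all add: power2_eq_square)
    \<comment> \<open>All three squares share the factor -i. After a^2 has been eliminated by the
      old isotropy relation, what remains is (b2^2 - b1^2) + (b1 + i b2)^2 / 2 = (b2 + i b1)^2 /
      2.\<close>
    then have sqA: "(- \<i> * \<omega> * x)\<^sup>2 = - \<i> * x\<^sup>2"
      and sqB: "(- \<i> * \<omega> / ?q * x)\<^sup>2 = - \<i> * (x\<^sup>2 / 2)" for x
      by (simp_all add: power_mult_distrib power_divide)
    have "(deriv ?A z)\<^sup>2 + (deriv ?B z)\<^sup>2 = - \<i> * ((b2\<^sup>2 - b1\<^sup>2) + (b1 + \<i> * b2)\<^sup>2 / 2)"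
      unfolding e1 sqA sqB n by (simp only: distrib_left)
    also have "\<dots> = - \<i> * ((b2 + \<i> * b1)\<^sup>2 / 2)"
      by (simp add: power2_eq_square field_simps)
    also have "\<dots> = (deriv ?B (\<i> * z))\<^sup>2"
      unfolding e2 sqB ..
    finally show "(deriv ?A z)\<^sup>2 + (deriv ?B z)\<^sup>2 = (deriv ?B (\<i> * z))\<^sup>2" .
  qed
  \<comment> \<open>The total factor is -i \<omega> (1 + i) / sqrt 2 = -i \<omega>^2 = 1.\<close>
  moreover have "deriv ?B 0 = deriv B 0"
  proof -
    have "deriv ?B 0 = - \<i> * \<omega> / ?q * ((1 + \<i>) * deriv B 0)"
      using dB[of 0] \<open>r > 0\<close> by (simp add: algebra_simps)
    also have "\<dots> = - \<i> * (\<omega> * \<omega>) * deriv B 0"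
      unfolding omega(4)[symmetric] using q0 by (simp add: field_simps)
    finally show ?thesis by (simp add: omega)
  qed
  \<comment> \<open>Two derivatives contribute \<omega>^2 = i, which cancels -i. The positivity at
    0, and with it the side to which the curve bends, is therefore inherited.\<close>
  moreover have "deriv (deriv ?A) 0 = deriv (deriv A) 0"
  proof -
    have "deriv (deriv ?A) 0 = deriv (\<lambda>z. - \<i> * \<omega> * deriv A (\<omega> * z)) 0"
      by (rule deriv_eq_on_ball[of 0 r, OF dA]) (use \<open>r > 0\<close> in auto)
    also have "\<dots> = - \<i> * \<omega> * (\<omega> * deriv (deriv A) (\<omega> * 0))"
      using \<open>r > 0\<close> A by (intro DERIV_imp_deriv DERIV_cmult D[of "deriv A" r])
        (auto simp: omega intro!: holomorphic_deriv)
    also have "\<dots> = - \<i> * (\<omega> * \<omega>) * deriv (deriv A) 0" by simp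
    finally show ?thesis by (simp add: omega)
  qed
  ultimately show ?thesis using nz by (simp add: cpg_pair_def)
qed

section \<open>The surface of a self-CPG pair\<close>

lemma inner_real3: "x \<bullet> y = x $ 1 * y $ 1 + x $ 2 * y $ 2 + x $ 3 * y $ 3" for x y :: "real ^ 3"
  by (simp add: inner_vec_def sum_3)

lemma holomorphic_extension_cong:
  "\<lbrakk>holomorphic_extension \<Omega> I f F; \<And>t. t \<in> I \<Longrightarrow> f t = g t\<rbrakk> \<Longrightarrow> holomorphic_extension \<Omega> I g F"
  by (simp add: holomorphic_extension_def)

lemma holomorphic_extension_affine:
  assumes "holomorphic_extension \<Omega> I g G"
  shows "holomorphic_extension \<Omega> I (\<lambda>t. Q *v g t + d)
    (\<lambda>z. \<chi> i. (\<Sum>j\<in>UNIV. of_real (Q $ i $ j) * G z $ j) + of_real (d $ i))"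
  using assms
  by (auto simp: holomorphic_extension_def matrix_vector_mult_def intro!: holomorphic_intros)

definition cpg_curve :: "(complex \<Rightarrow> complex) \<Rightarrow> (complex \<Rightarrow> complex) \<Rightarrow> real \<Rightarrow> real ^ 3" where
  "cpg_curve A B t = vector [Re (A (of_real t)), Re (B (of_real t)), 0]"

text \<open>The velocity turned clockwise by a right angle and divided by B'(it), a square root of
  the squared speed by isotropy. As a denominator it extends holomorphically, and the choice of root
  makes the normal (1, 0, 0) at the vertex.\<close>

definition cpg_normal :: "(complex \<Rightarrow> complex) \<Rightarrow> (complex \<Rightarrow> complex) \<Rightarrow> real \<Rightarrow> real ^ 3" where
  "cpg_normal A B t = vector [Re (deriv B (of_real t)) / Re (deriv B (\<i> * of_real t)),
     - Re (deriv A (of_real t)) / Re (deriv B (\<i> * of_real t)), 0]"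

definition cpg_surface :: "(complex \<Rightarrow> complex) \<Rightarrow> (complex \<Rightarrow> complex) \<Rightarrow> complex \<Rightarrow> real ^ 3" where
  "cpg_surface A B z = vector [Re (A z), Re (B z), - Re (B (\<i> * z))]"

lemma complex_of_real_Re: "x \<in> \<real> \<Longrightarrow> complex_of_real (Re x) = x"
  by (simp add: of_real_Re)

text \<open>On the real axis isotropy becomes \<alpha>^2 + \<beta>^2 = \<rho>^2 for the real numbers
  \<alpha> = A'(t), \<beta> = B'(t), \<rho> = B'(it); this makes the normal a unit vector. The last
  conclusion compares it with the surface: the partial derivatives are (\<alpha>, \<beta>, 0) and
  (0, 0, \<rho>), whose cross product is \<rho>^2 times the normal.\<close>

lemma cpg_pair_geometry:
  assumes P: "cpg_pair r A B" and nv: "\<And>z. z \<in> ball 0 r \<Longrightarrow> deriv B z \<noteq> 0" and "r > 0"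
  defines "J \<equiv> {-r<..<r}"
  shows cpg_curve_extension:
      "holomorphic_extension (ball 0 r) J (cpg_curve A B) (\<lambda>z. vector [A z, B z, 0])"
    and cpg_normal_extension:
      "holomorphic_extension (ball 0 r) J (cpg_normal A B)
         (\<lambda>z. vector [deriv B z / deriv B (\<i> * z), - deriv A z / deriv B (\<i> * z), 0])"
    and cpg_curve_velocity: "\<And>t. t \<in> J \<Longrightarrow>
      velocity (cpg_curve A B) t = vector [Re (deriv A (of_real t)), Re (deriv B (of_real t)), 0]"
    and cpg_curve_regular: "\<And>t. t \<in> J \<Longrightarrow> velocity (cpg_curve A B) t \<noteq> 0"
    and cpg_normal_unit: "\<And>t. t \<in> J \<Longrightarrow> norm (cpg_normal A B t) = 1"
    and cpg_normal_perp: "\<And>t. t \<in> J \<Longrightarrow> cpg_normal A B t \<bullet> velocity (cpg_curve A B) t = 0"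
    and cpg_curve_curvature: "curvature_vector (cpg_curve A B) 0 =
      norm (curvature_vector (cpg_curve A B) 0) *\<^sub>R cpg_normal A B 0"
      "curvature_vector (cpg_curve A B) 0 \<noteq> 0"
    and cpg_normal_cross: "\<And>t. t \<in> J \<Longrightarrow>
      \<exists>\<mu>>0. cross3 (\<chi> j. Re (deriv (\<lambda>z. vector [A z, B z, - B (\<i> * z)] $ j) (of_real t)))
         (\<chi> j. - Im (deriv (\<lambda>z. vector [A z, B z, - B (\<i> * z)] $ j) (of_real t))) =
         \<mu> *\<^sub>R cpg_normal A B t"
proof -
  have A: "A holomorphic_on ball 0 r" and B: "B holomorphic_on ball 0 r"
    and sym: "\<And>z. z \<in> ball 0 r \<Longrightarrow> A (cnj z) = cnj (A z)"
      "\<And>z. z \<in> ball 0 r \<Longrightarrow> B (cnj z) = cnj (B z)"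
    and null: "\<And>z. z \<in> ball 0 r \<Longrightarrow> (deriv A z)\<^sup>2 + (deriv B z)\<^sup>2 = (deriv B (\<i> * z))\<^sup>2"
    and pos: "Re (deriv (deriv A) 0) > 0"
    using P by (auto simp: cpg_pair_def)
  have dA: "deriv A holomorphic_on ball 0 r" and dB: "deriv B holomorphic_on ball 0 r"
    using A B by (auto intro: holomorphic_deriv)
  have J: "open J" "of_real ` J \<subseteq> ball (0::complex) r" by (auto simp: J_def)
  have reA: "complex_of_real (Re (A (of_real t))) = A (of_real t)"
    and reB: "complex_of_real (Re (B (of_real t))) = B (of_real t)" if "t \<in> J" for t
    using sym[of "of_real t"] that by (auto simp: J_def complex_eq_iff)
  have rdA: "complex_of_real (Re (deriv A (of_real t))) = deriv A (of_real t)"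
    and rdB: "complex_of_real (Re (deriv B (of_real t))) = deriv B (of_real t)"
    and rdB': "complex_of_real (Re (deriv B (\<i> * of_real t))) = deriv B (\<i> * of_real t)" if "t \<in> J" for t
    using cpg_pair_deriv_real[OF P, of t] that by (auto simp: J_def intro: complex_of_real_Re)
  have iz: "\<i> * z \<in> ball 0 r" if "z \<in> ball 0 r" for z using that by (simp add: norm_mult)
  show C: "holomorphic_extension (ball 0 r) J (cpg_curve A B) (\<lambda>z. vector [A z, B z, 0])"
    using A B by (auto simp: holomorphic_extension_def forall_3 cpg_curve_def reA reB)
  have dBi: "(\<lambda>z. deriv B (\<i> * z)) holomorphic_on ball 0 r"
    by (rule holomorphic_on_mult_arg[OF dB]) simp
  show N: "holomorphic_extension (ball 0 r) J (cpg_normal A B)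
         (\<lambda>z. vector [deriv B z / deriv B (\<i> * z), - deriv A z / deriv B (\<i> * z), 0])"
    using dA dB dBi nv[OF iz]
    by (auto simp: holomorphic_extension_def forall_3 cpg_normal_def rdA rdB rdB' intro!: holomorphic_intros)
  have dC: "holomorphic_extension (ball 0 r) J (velocity (cpg_curve A B)) (\<lambda>z. vector [deriv A z, deriv B z, 0])"
    using holomorphic_extension_deriv(2)[OF C open_ball J] by (simp add: holomorphic_extension_def forall_3)
  have ddC: "holomorphic_extension (ball 0 r) J (velocity (velocity (cpg_curve A B)))
      (\<lambda>z. vector [deriv (deriv A) z, deriv (deriv B) z, 0])"
    using holomorphic_extension_deriv(2)[OF dC open_ball J] by (simp add: holomorphic_extension_def forall_3)
  show vel: "velocity (cpg_curve A B) t = vector [Re (deriv A (of_real t)), Re (deriv B (of_real t)), 0]"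
    if "t \<in> J" for t
    using dC that by (auto simp: holomorphic_extension_def vec_eq_iff forall_3)
  have rdB0: "Re (deriv B (of_real t)) \<noteq> 0" "Re (deriv B (\<i> * of_real t)) \<noteq> 0" if "t \<in> J" for t
  proof -
    have "complex_of_real t \<in> ball 0 r" using that J by auto
    with nv[OF this] nv[OF iz[OF this]] show "Re (deriv B (of_real t)) \<noteq> 0" "Re (deriv B (\<i> * of_real t)) \<noteq> 0"
      using rdB[OF that] rdB'[OF that] by auto
  qed
  show "velocity (cpg_curve A B) t \<noteq> 0" if "t \<in> J" for t
    unfolding vel[OF that] using rdB0(1)[OF that] by (simp add: vec_eq_iff forall_3)
  have rnull: "(Re (deriv A (of_real t)))\<^sup>2 + (Re (deriv B (of_real t)))\<^sup>2 = (Re (deriv B (\<i> * of_real t)))\<^sup>2"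
    if "t \<in> J" for t
  proof -
    have "complex_of_real t \<in> ball 0 r" using that J by auto
    from null[OF this] have "complex_of_real ((Re (deriv A (of_real t)))\<^sup>2 + (Re (deriv B (of_real t)))\<^sup>2) =
        of_real ((Re (deriv B (\<i> * of_real t)))\<^sup>2)"
      by (simp only: of_real_add of_real_power rdA[OF that] rdB[OF that] rdB'[OF that])
    then show ?thesis by (simp only: of_real_eq_iff)
  qed
  show "norm (cpg_normal A B t) = 1" if "t \<in> J" for t
    using rnull[OF that] rdB0[OF that]
    by (simp add: norm_eq_1 inner_real3 cpg_normal_def field_simps power2_eq_square)
  show "cpg_normal A B t \<bullet> velocity (cpg_curve A B) t = 0" if "t \<in> J" for t
    unfolding vel[OF that] by (simp add: inner_real3 cpg_normal_def)
  have 0: "0 \<in> J" using \<open>r > 0\<close> by (simp add: J_def)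
  define p where "p = Re (deriv B 0)"
  define a where "a = Re (deriv (deriv A) 0)"
  have "p \<noteq> 0" using rdB0(1)[OF 0] by (simp add: p_def)
  have "a > 0" using pos by (simp add: a_def)
  have v0: "velocity (cpg_curve A B) 0 = vector [0, p, 0]"
    using vel[OF 0] cpg_pair_deriv_0(1)[OF P \<open>r > 0\<close>] by (simp add: p_def)
  have a0: "velocity (velocity (cpg_curve A B)) 0 = vector [a, 0, 0]"
    using ddC 0 cpg_pair_deriv_0(2)[OF P \<open>r > 0\<close>]
    by (auto simp: holomorphic_extension_def vec_eq_iff forall_3 a_def dest!: bspec[of _ _ 0])
  \<comment> \<open>At the vertex the velocity points along the y-axis and the acceleration along
    the x-axis, so the projection leaves the acceleration unchanged. Its positive coefficient
    matches the normal (1, 0, 0).\<close>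
  have curv: "curvature_vector (cpg_curve A B) 0 = (a / p\<^sup>2) *\<^sub>R vector [1, 0, 0]"
    using \<open>p \<noteq> 0\<close>
    by (simp add: curvature_vector_def v0 a0 Let_def inner_real3 vec_eq_iff forall_3 power2_eq_square)
  have n0: "cpg_normal A B 0 = vector [1, 0, 0]"
    using cpg_pair_deriv_0(1)[OF P \<open>r > 0\<close>] rdB0[OF 0] by (simp add: cpg_normal_def)
  have "norm (vector [1, 0, 0] :: real ^ 3) = 1" by (simp add: norm_eq_1 inner_real3)
  then show "curvature_vector (cpg_curve A B) 0 =
      norm (curvature_vector (cpg_curve A B) 0) *\<^sub>R cpg_normal A B 0"
    using \<open>a > 0\<close> by (simp add: curv n0)
  show "curvature_vector (cpg_curve A B) 0 \<noteq> 0"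
    using \<open>a > 0\<close> \<open>p \<noteq> 0\<close> by (simp add: curv vec_eq_iff forall_3)
  fix t assume t: "t \<in> J"
  then have tb: "complex_of_real t \<in> ball 0 r" using J by auto
  define \<alpha> where "\<alpha> = Re (deriv A (of_real t))"
  define \<beta> where "\<beta> = Re (deriv B (of_real t))"
  define \<rho> where "\<rho> = Re (deriv B (\<i> * of_real t))"
  have "deriv (\<lambda>z. - B (\<i> * z)) (of_real t) = - (\<i> * deriv B (\<i> * of_real t))"
    by (intro DERIV_imp_deriv DERIV_minus has_field_derivative_mult_arg[OF B _ tb]) simp
  then have d: "deriv (\<lambda>z. - B (\<i> * z)) (of_real t) = - \<i> * of_real \<rho>"
    "deriv A (of_real t) = of_real \<alpha>" "deriv B (of_real t) = of_real \<beta>"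
    unfolding \<alpha>_def \<beta>_def \<rho>_def rdA[OF t] rdB[OF t] rdB'[OF t] by simp_all
  have "\<rho> \<noteq> 0" using rdB0[OF t] by (simp add: \<rho>_def)
  have n: "cpg_normal A B t = vector [\<beta> / \<rho>, - \<alpha> / \<rho>, 0]"
    by (simp add: cpg_normal_def \<alpha>_def \<beta>_def \<rho>_def)
  have "cross3 (\<chi> j. Re (deriv (\<lambda>z. vector [A z, B z, - B (\<i> * z)] $ j) (of_real t)))
         (\<chi> j. - Im (deriv (\<lambda>z. vector [A z, B z, - B (\<i> * z)] $ j) (of_real t))) =
         \<rho>\<^sup>2 *\<^sub>R cpg_normal A B t"
    unfolding n using \<open>\<rho> \<noteq> 0\<close>
    by (simp add: cross3_def vec_eq_iff forall_3 d power2_eq_square)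
  then show "\<exists>\<mu>>0. cross3 (\<chi> j. Re (deriv (\<lambda>z. vector [A z, B z, - B (\<i> * z)] $ j) (of_real t)))
         (\<chi> j. - Im (deriv (\<lambda>z. vector [A z, B z, - B (\<i> * z)] $ j) (of_real t))) =
         \<mu> *\<^sub>R cpg_normal A B t"
    using \<open>\<rho> \<noteq> 0\<close> by (intro exI[of _ "\<rho>\<^sup>2"]) simp
qed

section \<open>The Bjoerling surface of a pair and its symmetries\<close>

lemma symmetric_interval_ball: "r > 0 \<Longrightarrow> symmetric_interval {-r<..<r}"
proof -
  assume "r > 0"
  have "uminus ` {-r<..<r} = {-r<..<r}"
    by (auto simp: image_iff intro!: bexI[of _ "- _"])
  then show ?thesis using \<open>r > 0\<close>
    by (auto simp: symmetric_interval_def is_interval_oo)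
qed

lemma symmetric_domain_ball: "r > 0 \<Longrightarrow> symmetric_domain (ball 0 r)"
proof -
  assume "r > 0"
  have "cnj ` ball 0 r = ball 0 r" by (auto simp: image_cnj_conv_vimage_cnj)
  moreover have "(\<lambda>w. \<i> * w) ` ball 0 r = ball 0 r"
  proof
    show "ball 0 r \<subseteq> (\<lambda>w. \<i> * w) ` ball 0 r"
    proof
      fix w :: complex assume "w \<in> ball 0 r"
      then have "w = \<i> * (- \<i> * w)" "- \<i> * w \<in> ball 0 r" by (simp_all add: norm_mult)
      then show "w \<in> (\<lambda>w. \<i> * w) ` ball 0 r" by (rule image_eqI)
    qed
  qed (auto simp: norm_mult)
  ultimately show ?thesis using \<open>r > 0\<close>
    by (simp add: symmetric_domain_def convex_imp_simply_connected)
qed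

text \<open>Isotropy reduces the integrand N x C' to (0, 0, B'(iz)), which has the explicit
  primitive -i B(iz) in its third component. Multiplied by -i this is the missing coordinate -B(iw)
  of the null curve.\<close>

lemma cpg_pair_bjoerling:
  assumes P: "cpg_pair r A B" and nv: "\<And>z. z \<in> ball 0 r \<Longrightarrow> deriv B z \<noteq> 0" and "r > 0"
    and k: "\<And>t. t \<in> {-r<..<r} \<Longrightarrow> k t = cpg_curve A B t"
  shows "is_bjoerling (ball 0 r) {-r<..<r} k (cpg_surface A B)"
proof -
  let ?J = "{-r<..<r}"
  let ?C = "\<lambda>z. vector [A z, B z, 0] :: complex ^ 3"
  let ?N = "\<lambda>z. vector [deriv B z / deriv B (\<i> * z), - deriv A z / deriv B (\<i> * z), 0] :: complex ^ 3"
  note geo = cpg_pair_geometry[OF P nv \<open>r > 0\<close>]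
  have J: "open ?J" "of_real ` ?J \<subseteq> ball (0::complex) r" by auto
  have 0: "0 \<in> ?J" using \<open>r > 0\<close> by simp
  have C: "holomorphic_extension (ball 0 r) ?J k ?C"
    by (rule holomorphic_extension_cong[OF geo(1)]) (simp_all add: k)
  have vel: "velocity k t = velocity (cpg_curve A B) t" if "t \<in> ?J" for t
    by (rule velocity_cong[OF J(1) that k])
  have curv: "curvature_vector k 0 = curvature_vector (cpg_curve A B) 0"
    by (rule curvature_vector_cong[OF J(1) 0 k])
  have "regular_analytic_curve ?J k"
    using holomorphic_extension_imp_real_analytic[OF C open_ball J] geo(4) vel
    by (simp add: regular_analytic_curve_def)
  moreover have "principal_normal_field ?J k (cpg_normal A B)"
    unfolding principal_normal_field_def
  proof (intro conjI exI ballI)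
    show "real_analytic_on (cpg_normal A B) ?J"
      by (rule holomorphic_extension_imp_real_analytic[OF geo(2) open_ball J])
    show "k ` ?J \<subseteq> plane_through 0 (vector [0, 0, 1])"
      by (auto simp: plane_through_def k cpg_curve_def inner_real3)
    show "(vector [0, 0, 1] :: real ^ 3) \<noteq> 0" by (simp add: vec_eq_iff forall_3)
    show "cpg_normal A B t \<bullet> vector [0, 0, 1] = 0" for t
      by (simp add: cpg_normal_def inner_real3)
    show "curvature_vector k 0 = norm (curvature_vector k 0) *\<^sub>R cpg_normal A B 0"
      unfolding curv by (rule geo(7))
  qed (use geo(5,6) vel in auto)
  moreover have "cpg_surface A B w $ j = Re (?C w $ j - \<i> * contour_integral g
        (\<lambda>z. complex_cross (?N z) (\<chi> j. deriv (\<lambda>\<zeta>. ?C \<zeta> $ j) z) $ j))"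
    if g: "valid_path g" "path_image g \<subseteq> ball 0 r" "pathstart g = 0" "pathfinish g = w" for w g j
  proof -
    have B: "B holomorphic_on ball 0 r" using P by (simp add: cpg_pair_def)
    have cross: "complex_cross (?N z) (\<chi> j. deriv (\<lambda>\<zeta>. ?C \<zeta> $ j) z) = vector [0, 0, deriv B (\<i> * z)]"
      if "z \<in> ball 0 r" for z
    proof -
      have "deriv B (\<i> * z) \<noteq> 0" using that by (intro nv) (simp add: norm_mult)
      moreover have "(deriv A z)\<^sup>2 + (deriv B z)\<^sup>2 = (deriv B (\<i> * z))\<^sup>2"
        using P that by (simp add: cpg_pair_def)
      ultimately show ?thesis
        by (simp add: complex_cross_def vec_eq_iff forall_3 field_simps power2_eq_square)
    qed
    have "contour_integral g (\<lambda>z. complex_cross (?N z) (\<chi> j. deriv (\<lambda>\<zeta>. ?C \<zeta> $ j) z) $ j) =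
        contour_integral g (\<lambda>z. vector [0, 0, deriv B (\<i> * z)] $ j)"
      by (rule contour_integral_eq) (use cross g(2) in auto)
    also have "\<dots> = vector [0, 0, - \<i> * B (\<i> * w)] $ j"
    proof -
      have "((\<lambda>z. - \<i> * B (\<i> * z)) has_field_derivative deriv B (\<i> * z)) (at z within ball 0 r)"
        if "z \<in> ball 0 r" for z
        using DERIV_cmult[OF has_field_derivative_mult_arg[OF B _ that, of \<i>], of "- \<i>"]
        by (simp add: has_field_derivative_at_within)
      from contour_integral_primitive[OF this g(1,2)]
      have "contour_integral g (\<lambda>z. deriv B (\<i> * z)) = - \<i> * B (\<i> * w) - - \<i> * B 0"
        by (simp add: contour_integral_unique g)
      moreover have "B 0 = 0"
      proof -
        have "0 \<in> ball (0::complex) r" using \<open>r > 0\<close> by simp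
        then have "B (- 0) = - B 0" using P unfolding cpg_pair_def by blast
        then show ?thesis by simp
      qed
      ultimately show ?thesis using exhaust_3[of j] by auto
    qed
    finally show ?thesis
      using exhaust_3[of j] by (auto simp: cpg_surface_def)
  qed
  ultimately show ?thesis
    unfolding is_bjoerling_def
    using C geo(2) by blast
qed

text \<open>The third coordinate vanishes because \<open>B\<close>, being odd and real, takes
  imaginary values on the imaginary axis.\<close>

lemma cpg_surface_real:
  assumes "cpg_pair r A B" "\<bar>t\<bar> < r"
  shows "cpg_surface A B (of_real t) = cpg_curve A B t"
proof -
  have "\<i> * of_real t \<in> ball 0 r" using assms(2) by (simp add: norm_mult)
  then have "B (cnj (\<i> * of_real t)) = cnj (B (\<i> * of_real t))"
    and "B (- (\<i> * of_real t)) = - B (\<i> * of_real t)"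
    using assms(1) unfolding cpg_pair_def by blast+
  then have "- B (\<i> * of_real t) = cnj (B (\<i> * of_real t))" by simp
  from arg_cong[OF this, of Re] have "Re (B (\<i> * of_real t)) = 0" by simp
  then show ?thesis by (simp add: cpg_surface_def cpg_curve_def)
qed

lemma cpg_surface_Lambda:
  assumes "cpg_pair r A B" "\<bar>t\<bar> < r"
  shows "cpg_surface A B (\<i> * of_real t) = Lambda *v cpg_surface A B (of_real t)"
proof -
  have "A (\<i> * of_real t) = - A (of_real t)" "B (- of_real t) = - B (of_real t)"
    using assms by (auto simp: cpg_pair_def)
  then show ?thesis
    by (simp add: cpg_surface_def Lambda_def vec_eq_iff forall_3 matrix_vector_mult_def sum_3)
qed

text \<open>Two quarter turns make \<open>A\<close> even, while \<open>B\<close> is odd; this is the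
  reflection in the x-axis.\<close>

lemma cpg_curve_symmetric:
  assumes "cpg_pair r A B" "\<bar>t\<bar> < r"
  shows "cpg_curve A B (- t) = vector [cpg_curve A B t $ 1, - (cpg_curve A B t $ 2), 0]"
proof -
  have z: "of_real t \<in> ball (0::complex) r" "\<i> * of_real t \<in> ball 0 r" using assms(2) by (auto simp: norm_mult)
  have "A (\<i> * (\<i> * of_real t)) = - A (\<i> * of_real t)" "A (\<i> * of_real t) = - A (of_real t)"
     "B (- of_real t) = - B (of_real t)"
    using assms(1) z unfolding cpg_pair_def by blast+
  then show ?thesis by (simp add: cpg_curve_def)
qed

section \<open>Transfer to a surface known through a conformal chart and a rigid motion\<close>

lemma reflect_line_rotation:
  assumes "orthogonal_matrix Q"
  shows "reflect_line d (Q *v a) (Q *v x + d) = Q *v reflect_line 0 a x + d"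
proof -
  have "reflect_line d (Q *v a) (Q *v x + d) =
      2 *\<^sub>R (((x \<bullet> a) / (a \<bullet> a)) *\<^sub>R (Q *v a)) + 2 *\<^sub>R d - (Q *v x + d)"
    by (simp add: reflect_line_def inner_orthogonal_matrix[OF assms] algebra_simps)
  also have "\<dots> = Q *v reflect_line 0 a x + d"
    by (simp add: reflect_line_def matrix_vector_mult_diff_distrib matrix_vector_mult_scaleR algebra_simps)
      (simp add: vec_eq_iff)
  finally show ?thesis .
qed

lemma reflect_line_e1: "reflect_line 0 (axis 1 1) x = vector [x $ 1, - (x $ 2), - (x $ 3)]"
  by (simp add: reflect_line_def vec_eq_iff forall_3 inner_real3 axis_def)

lemma velocity_id: "velocity (\<lambda>s::real. s) = (\<lambda>_. 1)"
  by (rule ext, rule velocity_eq) (rule has_vector_derivative_id[unfolded id_def])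

lemma rigid_curve:
  assumes A: "orthogonal_matrix A" and "open J" "s \<in> J"
    and k: "\<And>s. s \<in> J \<Longrightarrow> k s = A *v c s + b"
    and c: "\<And>t. t \<in> J \<Longrightarrow> (c has_vector_derivative velocity c t) (at t)"
      "\<And>t. t \<in> J \<Longrightarrow> (velocity c has_vector_derivative velocity (velocity c) t) (at t)"
  shows "velocity k s = A *v velocity c s" "curvature_vector k s = A *v curvature_vector c s"
proof -
  have id: "((\<lambda>s::real. s) has_vector_derivative velocity (\<lambda>s. s) t) (at t)" for t
    by (simp add: velocity_id has_vector_derivative_id[unfolded id_def])
  have "(velocity (\<lambda>s::real. s) has_vector_derivative velocity (velocity (\<lambda>s. s)) s) (at s)"
    unfolding velocity_id using velocity_eq[OF has_vector_derivative_const[of "1::real" "at s"]] by simp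
  with rigid_reparametrization[where \<phi> = "\<lambda>s. s" and k = k and c = c and I = J, OF A \<open>open J\<close> _ k c(1) id] c(2) \<open>s \<in> J\<close>
  show "velocity k s = A *v velocity c s" "curvature_vector k s = A *v curvature_vector c s"
    by (simp_all add: velocity_id)
qed

text \<open>The two arguments are the real part and the negative imaginary part of (a + ib)(x + iy).
  A holomorphic change of parameter thus scales the cross product of the partial derivatives by a
  positive number and never flips the normal.\<close>

lemma cross3_conformal:
  "cross3 (a *\<^sub>R x - b *\<^sub>R y) (- (a *\<^sub>R y + b *\<^sub>R x)) = (a\<^sup>2 + b\<^sup>2) *\<^sub>R cross3 x (- y)"
  by (simp add: cross3_def vec_eq_iff forall_3 power2_eq_square algebra_simps)

text \<open>\<open>Y\<close> is known only in the chart \<open>\<Psi>\<close>, but its partial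
  derivatives are taken in its own coordinate. The holomorphic inverse of \<open>\<Psi>\<close>
  writes \<open>Y\<close> as a real part near the arc, and the chain rule brings in a single nonzero
  complex factor common to all components.\<close>

lemma cpg_surface_normal:
  assumes P: "cpg_pair r A B" and nv: "\<And>z. z \<in> ball 0 r \<Longrightarrow> deriv B z \<noteq> 0" and "r > 0"
    and \<Psi>: "\<Psi> holomorphic_on ball 0 r" "inj_on \<Psi> (ball 0 r)"
    and Q: "orthogonal_matrix Q" "det Q = 1"
    and Y: "\<And>z. z \<in> ball 0 r \<Longrightarrow> Y (\<Psi> z) = Q *v cpg_surface A B z + d"
    and t: "t \<in> {-r<..<r}"
  shows "surface_normal Y (\<Psi> (of_real t)) = Q *v cpg_normal A B t"
proof -
  have A: "A holomorphic_on ball 0 r" and B: "B holomorphic_on ball 0 r"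
    using P by (auto simp: cpg_pair_def)
  obtain g where g: "g holomorphic_on \<Psi> ` ball 0 r"
    and g1: "\<And>z. z \<in> ball 0 r \<Longrightarrow> deriv \<Psi> z * deriv g (\<Psi> z) = 1"
    and g2: "\<And>z. z \<in> ball 0 r \<Longrightarrow> g (\<Psi> z) = z"
    using holomorphic_has_inverse[OF \<Psi>(1) open_ball \<Psi>(2)] by blast
  define S where "S = \<Psi> ` ball 0 r"
  have S: "open S" unfolding S_def by (rule open_mapping_thm3[OF \<Psi>(1) open_ball \<Psi>(2)])
  have tb: "complex_of_real t \<in> ball 0 r" using t by auto
  define w where "w = \<Psi> (of_real t)"
  have w: "w \<in> S" using tb by (simp add: w_def S_def)
  have gw: "g w = of_real t" using g2[OF tb] by (simp add: w_def)
  define G where "G i z = (vector [A z, B z, - B (\<i> * z)] :: complex ^ 3) $ i" for i z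
  have G: "G i holomorphic_on ball 0 r" for i
  proof -
    have "(\<lambda>z. B (\<i> * z)) holomorphic_on ball 0 r"
      by (rule holomorphic_on_mult_arg[OF B]) simp
    then show ?thesis
      using A B exhaust_3[of i] by (auto simp: G_def [abs_def] intro!: holomorphic_intros)
  qed
  define H where "H j z = (\<Sum>i\<in>UNIV. of_real (Q $ j $ i) * G i (g z)) + of_real (d $ j)" for j z
  have gS: "g ` S \<subseteq> ball 0 r" using g2 by (auto simp: S_def)
  have Gg: "(\<lambda>z. G i (g z)) holomorphic_on S" for i
    using holomorphic_on_compose_gen[OF g G, of i] gS by (auto simp: o_def S_def)
  have H: "H j holomorphic_on S" for j
    unfolding H_def by (intro holomorphic_intros Gg)
  have YH: "Y z $ j = Re (H j z)" if zS: "z \<in> S" for z j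
  proof -
    obtain x where x: "x \<in> ball 0 r" "z = \<Psi> x" using zS unfolding S_def by blast
    have "cpg_surface A B x $ i = Re (G i x)" for i
      using exhaust_3[of i] by (auto simp: cpg_surface_def G_def)
    then show ?thesis
      unfolding x(2) Y[OF x(1)] by (simp add: H_def g2[OF x(1)] matrix_vector_mult_def)
  qed
  define \<mu> where "\<mu> = deriv g w"
  have "\<mu> \<noteq> 0" using g1[OF tb] by (auto simp: \<mu>_def w_def)
  define x where "x = (\<chi> i. Re (deriv (G i) (of_real t)))"
  define y where "y = (\<chi> i. Im (deriv (G i) (of_real t)))"
  have dH: "deriv (H j) w = \<mu> * (\<Sum>i\<in>UNIV. of_real (Q $ j $ i) * deriv (G i) (of_real t))" for j
  proof -
    have "(G i has_field_derivative deriv (G i) (of_real t)) (at (g w))" for i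
      unfolding gw by (intro holomorphic_derivI[OF G] tb) simp
    moreover have "(g has_field_derivative \<mu>) (at w)"
      unfolding \<mu>_def using g S w by (intro holomorphic_derivI[where S = S]) (auto simp: S_def)
    ultimately have "((\<lambda>z. G i (g z)) has_field_derivative deriv (G i) (of_real t) * \<mu>) (at w)" for i
      by (rule DERIV_chain2)
    then have "(H j has_field_derivative
        (\<Sum>i\<in>UNIV. of_real (Q $ j $ i) * (deriv (G i) (of_real t) * \<mu>)) + 0) (at w)"
      unfolding H_def by (intro DERIV_add DERIV_sum DERIV_cmult DERIV_const)
    then show ?thesis by (simp add: DERIV_imp_deriv sum_distrib_left mult_ac)
  qed
  have pu: "partial_u Y w = (\<chi> j. Re (deriv (H j) w))"
    and pv: "partial_v Y w = (\<chi> j. - Im (deriv (H j) w))"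
    by (rule partial_re_holomorphic[OF S w H YH]; assumption)+
  have "partial_u Y w = Q *v (Re \<mu> *\<^sub>R x - Im \<mu> *\<^sub>R y)"
    and "partial_v Y w = Q *v (- (Re \<mu> *\<^sub>R y + Im \<mu> *\<^sub>R x))"
    unfolding pu pv dH
    by (auto simp: vec_eq_iff matrix_vector_mult_def x_def y_def sum_3 algebra_simps)
  then have "cross3 (partial_u Y w) (partial_v Y w) = (cmod \<mu>)\<^sup>2 *\<^sub>R (Q *v cross3 x (- y))"
    by (simp only: cross3_rotation[OF Q] cross3_conformal matrix_vector_mult_scaleR cmod_power2)
  moreover obtain \<nu> where "\<nu> > 0" "cross3 x (- y) = \<nu> *\<^sub>R cpg_normal A B t"
  proof -
    have "- y = (\<chi> j. - Im (deriv (G j) (of_real t)))" by (simp add: y_def vec_eq_iff)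
    then show ?thesis
      using cpg_normal_cross[OF P nv \<open>r > 0\<close> t] that unfolding x_def G_def [abs_def] by auto
  qed
  ultimately have cr: "cross3 (partial_u Y w) (partial_v Y w) =
      ((cmod \<mu>)\<^sup>2 * \<nu>) *\<^sub>R (Q *v cpg_normal A B t)"
    by (simp add: matrix_vector_mult_scaleR)
  have "norm (Q *v cpg_normal A B t) = 1"
    using cpg_normal_unit[OF P nv \<open>r > 0\<close> t] by (simp add: norm_orthogonal_matrix[OF Q(1)])
  then show ?thesis
    using \<open>\<mu> \<noteq> 0\<close> \<open>\<nu> > 0\<close> unfolding surface_normal_def w_def[symmetric] cr by simp
qed

text \<open>The curve already runs in a suitable parameter, so the identity serves as change of
  parameter, and the disc with \<open>cpg_surface A B\<close> as the domain and surface demanded of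
  a self-CPG curve. The given domain \<Omega> matters only for the arc and the normal of
  \<open>Y\<close>.\<close>

lemma cpg_pair_generates:
  assumes P: "cpg_pair r A B" and nv: "\<And>z. z \<in> ball 0 r \<Longrightarrow> deriv B z \<noteq> 0" and "r > 0"
    and \<Psi>: "\<Psi> holomorphic_on ball 0 r" "inj_on \<Psi> (ball 0 r)" "\<Psi> ` ball 0 r \<subseteq> \<Omega>"
    and Q: "orthogonal_matrix Q" "det Q = 1"
    and Y: "\<And>z. z \<in> ball 0 r \<Longrightarrow> Y (\<Psi> z) = Q *v cpg_surface A B z + d"
  shows "self_CPG {-r<..<r} (\<lambda>t. Y (\<Psi> (of_real t)))"
    and "generated_along \<Omega> Y {-r<..<r} (\<lambda>t. \<Psi> (of_real t)) (\<lambda>t. Y (\<Psi> (of_real t)))"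
proof -
  let ?J = "{-r<..<r}"
  let ?k = "cpg_curve A B"
  let ?n = "cpg_normal A B"
  let ?c = "\<lambda>t. Y (\<Psi> (of_real t))"
  note geo = cpg_pair_geometry[OF P nv \<open>r > 0\<close>]
  have J: "open ?J" "of_real ` ?J \<subseteq> ball (0::complex) r" by auto
  have 0: "0 \<in> ?J" using \<open>r > 0\<close> by simp
  have c: "?c t = Q *v ?k t + d" if "t \<in> ?J" for t
    using Y[of "of_real t"] cpg_surface_real[OF P, of t] that by auto
  have k_diff: "(?k has_vector_derivative velocity ?k t) (at t)"
    "(velocity ?k has_vector_derivative velocity (velocity ?k) t) (at t)" if "t \<in> ?J" for t
    using holomorphic_extension_deriv(1)[OF geo(1) open_ball J that]
      holomorphic_extension_deriv(1)[OF holomorphic_extension_deriv(2)[OF geo(1) open_ball J] open_ball J that]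
    by auto
  have vel: "velocity ?c t = Q *v velocity ?k t" if "t \<in> ?J" for t
    using that by (intro rigid_curve[OF Q(1) J(1) that c k_diff])
  have curv: "curvature_vector ?c 0 = Q *v curvature_vector ?k 0"
    by (intro rigid_curve[OF Q(1) J(1) 0 c k_diff])
  have "real_analytic_on ?c ?J"
    by (rule holomorphic_extension_imp_real_analytic[OF
        holomorphic_extension_cong[OF holomorphic_extension_affine[OF geo(1), of Q d] c[symmetric]] open_ball J])
  then have reg: "regular_analytic_curve ?J ?c"
    using geo(4) by (simp add: regular_analytic_curve_def vel orthogonal_matrix_eq_0_iff[OF Q(1)])
  have plane: "?c ` ?J \<subseteq> plane_through d (Q *v axis 3 1)"
  proof -
    have "(Q *v ?k t) \<bullet> (Q *v axis 3 1) = 0" for t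
      unfolding inner_orthogonal_matrix[OF Q(1)] by (simp add: inner_real3 axis_def cpg_curve_def)
    then show ?thesis by (auto simp: plane_through_def c)
  qed
  have e: "Q *v axis 3 1 \<noteq> 0" "Q *v axis 1 1 \<noteq> 0"
    by (auto simp: orthogonal_matrix_eq_0_iff[OF Q(1)] axis_eq_0_iff)
  have sym: "reflect_line 0 (axis 1 1) (?k t) = ?k (- t)" if "t \<in> ?J" for t
    using cpg_curve_symmetric[OF P, of t] that by (auto simp: reflect_line_e1 cpg_curve_def)
  have "perpendicular_symmetric ?J ?c"
    unfolding perpendicular_symmetric_def
  proof (intro conjI exI ballI)
    show "(Q *v axis 1 1) \<bullet> (Q *v axis 3 1) = 0"
      by (simp add: inner_orthogonal_matrix[OF Q(1)] inner_axis_axis)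
    show "reflect_line d (Q *v axis 1 1) (?c t) = ?c (- t)" if t: "t \<in> ?J" for t
    proof -
      have "- t \<in> ?J" using t by auto
      then show ?thesis using c[OF t] c[of "- t"] sym[OF t] by (simp only: reflect_line_rotation[OF Q(1)])
    qed
    \<comment> \<open>The symmetries force A(0) = B(0) = 0, so the vertex is moved to
      \<open>d\<close>, the base point chosen on the axis.\<close>
    have z: "0 \<in> ball (0::complex) r" using \<open>r > 0\<close> by simp
    then have "A (\<i> * 0) = - A 0" "B (- 0) = - B 0" using P unfolding cpg_pair_def by blast+
    then have "?k 0 = 0" by (simp add: cpg_curve_def vec_eq_iff forall_3)
    then show "?c 0 = d + 0 *\<^sub>R (Q *v axis 1 1)" using c[OF 0] by simp
    have "velocity ?k 0 $ 1 = 0"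
      using cpg_curve_velocity[OF P nv \<open>r > 0\<close> 0] cpg_pair_deriv_0(1)[OF P \<open>r > 0\<close>] by simp
    then show "velocity ?c 0 \<bullet> (Q *v axis 1 1) = 0"
      unfolding vel[OF 0] inner_orthogonal_matrix[OF Q(1)] by (simp add: inner_real3 axis_def)
  qed (use reg e plane in auto)
  moreover have "nondegenerate ?c"
    using geo(8) by (simp add: nondegenerate_def curv orthogonal_matrix_eq_0_iff[OF Q(1)])
  moreover have "suitable_parameter ?J ?c ?J (\<lambda>t. t)"
  proof -
    \<comment> \<open>The inverse of the motion x |-> Qx + d, which puts the curve back into normal
      position.\<close>
    define T where "T x = transpose Q *v x + (- (transpose Q *v d))" for x
    have T: "rigid_motion T"
      unfolding rigid_motion_def
      by (rule exI[of _ "transpose Q"], rule exI[of _ "- (transpose Q *v d)"])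
        (use Q in \<open>auto simp: T_def [abs_def] orthogonal_matrix_transpose det_transpose\<close>)
    have Tc: "(T \<circ> ?c \<circ> (\<lambda>t. t)) t = ?k t" if "t \<in> ?J" for t
      unfolding o_def T_def c[OF that] matrix_vector_right_distrib
        transpose_orthogonal_matrix_cancel[OF Q(1)] by simp
    have Tm: "(T \<circ> ?c \<circ> (\<lambda>t. t)) (- t) = ?k (- t)" if "t \<in> ?J" for t
      by (rule Tc) (use that in auto)
    have "real_analytic_on (\<lambda>t::real. t) ?J"
      unfolding real_analytic_on_def
    proof
      fix t assume "t \<in> ?J"
      \<comment> \<open>The expansion of the identity about t is t + 1 (s - t), with no further
        terms.\<close>
      have "(\<lambda>k. (s - t) ^ k *\<^sub>R (if k = 0 then t else if k = 1 then 1 else 0)) sums s" for s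
        using sums_finite[of "{0, 1::nat}" "\<lambda>k. (s - t) ^ k *\<^sub>R (if k = 0 then t else if k = 1 then 1 else 0)"]
        by simp
      then show "\<exists>r>0. \<exists>a. \<forall>s. \<bar>s - t\<bar> < r \<longrightarrow> (\<lambda>k. (s - t) ^ k *\<^sub>R a k) sums s"
        by (intro exI[of _ 1] conjI exI[of _ "\<lambda>k. if k = 0 then t else if k = 1 then 1 else 0"]) auto
    qed
    then have "regular_analytic_curve ?J (\<lambda>t. t)"
      by (simp add: regular_analytic_curve_def velocity_id)
    moreover have "is_bjoerling (ball 0 r) ?J (T \<circ> ?c \<circ> (\<lambda>t. t)) (cpg_surface A B)"
      by (rule cpg_pair_bjoerling[OF P nv \<open>r > 0\<close> Tc])
    moreover have "\<forall>s\<in>?J. cpg_surface A B (\<i> * of_real s) = Lambda *v cpg_surface A B (of_real s)"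
      using cpg_surface_Lambda[OF P] by auto
    moreover have "\<forall>s\<in>?J. (T \<circ> ?c \<circ> (\<lambda>t. t)) s $ 3 = 0 \<and>
        reflect_line 0 (axis 1 1) ((T \<circ> ?c \<circ> (\<lambda>t. t)) s) = (T \<circ> ?c \<circ> (\<lambda>t. t)) (- s)"
    proof
      fix s assume s: "s \<in> ?J"
      show "(T \<circ> ?c \<circ> (\<lambda>t. t)) s $ 3 = 0 \<and>
        reflect_line 0 (axis 1 1) ((T \<circ> ?c \<circ> (\<lambda>t. t)) s) = (T \<circ> ?c \<circ> (\<lambda>t. t)) (- s)"
        unfolding Tc[OF s] Tm[OF s] sym[OF s] by (simp add: cpg_curve_def)
    qed
    ultimately show ?thesis
      unfolding suitable_parameter_def
      using symmetric_interval_ball[OF \<open>r > 0\<close>] symmetric_domain_ball[OF \<open>r > 0\<close>] J(2) T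
      by (intro conjI exI[of _ T] exI[of _ "T \<circ> ?c \<circ> (\<lambda>t. t)"] exI[of _ "ball 0 r"] exI[of _ "cpg_surface A B"])
        (auto simp: bij_betw_def)
  qed
  ultimately show "self_CPG ?J ?c"
    using symmetric_interval_ball[OF \<open>r > 0\<close>] unfolding self_CPG_def by blast
  have "real_analytic_on (\<lambda>t. \<Psi> (of_real t)) ?J"
    by (rule real_analytic_holomorphic[OF \<Psi>(1) open_ball J(2)])
  moreover have "velocity (\<lambda>t. \<Psi> (of_real t)) t \<noteq> 0" if "t \<in> ?J" for t
  proof -
    have tb: "complex_of_real t \<in> ball 0 r" using that by auto
    have "((\<lambda>t. \<Psi> (of_real t)) has_vector_derivative deriv \<Psi> (of_real t)) (at t)"
      by (intro has_vector_derivative_real_field holomorphic_derivI[OF \<Psi>(1) open_ball tb])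
    then show ?thesis
      using holomorphic_injective_imp_regular[OF \<Psi>(1) open_ball \<Psi>(2) tb] by (simp add: velocity_eq)
  qed
  moreover have "inj_on (\<lambda>t. \<Psi> (of_real t)) ?J"
  proof (rule inj_onI)
    fix x y assume "x \<in> ?J" "y \<in> ?J" and eq: "\<Psi> (complex_of_real x) = \<Psi> (complex_of_real y)"
    then have "complex_of_real x \<in> ball 0 r" "complex_of_real y \<in> ball 0 r" by auto
    from inj_onD[OF \<Psi>(2) eq this] show "x = y" by simp
  qed
  moreover have "principal_normal_field ?J ?c (\<lambda>t. Q *v ?n t)"
    unfolding principal_normal_field_def
  proof (intro conjI exI ballI)
    show "real_analytic_on (\<lambda>t. Q *v ?n t) ?J"
      using holomorphic_extension_imp_real_analytic[OF
        holomorphic_extension_affine[OF geo(2), of Q 0] open_ball J] by simp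
    show "(Q *v ?n t) \<bullet> (Q *v axis 3 1) = 0" for t
      unfolding inner_orthogonal_matrix[OF Q(1)] by (simp add: inner_real3 axis_def cpg_normal_def)
    show "curvature_vector ?c 0 = norm (curvature_vector ?c 0) *\<^sub>R (Q *v ?n 0)"
      unfolding curv norm_orthogonal_matrix[OF Q(1)] matrix_vector_mult_scaleR[symmetric]
      by (rule arg_cong[OF cpg_curve_curvature(1)[OF P nv \<open>r > 0\<close>]])
  qed (use e plane geo(5,6) vel in \<open>auto simp: norm_orthogonal_matrix[OF Q(1)] inner_orthogonal_matrix[OF Q(1)]\<close>)
  moreover have "Q *v ?n t = surface_normal Y (\<Psi> (of_real t))" if "t \<in> ?J" for t
    by (rule cpg_surface_normal[OF P nv \<open>r > 0\<close> \<Psi>(1,2) Q Y that, symmetric])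
  moreover have img: "(\<lambda>t. \<Psi> (of_real t)) ` ?J \<subseteq> \<Omega>" using \<Psi>(3) J(2) by blast
  ultimately show "generated_along \<Omega> Y ?J (\<lambda>t. \<Psi> (of_real t)) ?c"
    using reg img unfolding generated_along_def regular_analytic_curve_def[of ?J "\<lambda>t. \<Psi> (of_real t)"]
    by (intro conjI exI[of _ "\<lambda>t. Q *v ?n t"]) auto
qed

section \<open>The null curve of a self-CPG curve\<close>

lemma planar_velocity:
  assumes "open I" "t \<in> I" "c ` I \<subseteq> plane_through p e"
    and c: "(c has_vector_derivative velocity c t) (at t)"
  shows "velocity c t \<bullet> e = 0"
proof -
  have "((\<lambda>s. c s \<bullet> e) has_vector_derivative velocity c t \<bullet> e) (at t)"
    by (rule bounded_linear.has_vector_derivative[OF bounded_linear_inner_left c])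
  moreover have "((\<lambda>s. c s \<bullet> e) has_vector_derivative 0) (at t)"
  proof (rule has_vector_derivative_transform_within_open[OF _ \<open>open I\<close> \<open>t \<in> I\<close>])
    show "((\<lambda>s. p \<bullet> e) has_vector_derivative 0) (at t)" by simp
    show "p \<bullet> e = c s \<bullet> e" if "s \<in> I" for s
      using assms(3) that by (auto simp: plane_through_def inner_diff_left)
  qed
  ultimately show ?thesis using vector_derivative_unique_at by blast
qed

text \<open>The Bjoerling surface of \<open>k\<close> with normal field \<open>n\<close> is the real part of \<open>K - iW\<close>, where
  \<open>K\<close> extends \<open>k\<close> and \<open>W\<close> is as below.\<close>

definition normal_primitive ::
  "real \<Rightarrow> (real \<Rightarrow> real ^ 3) \<Rightarrow> (real \<Rightarrow> real ^ 3) \<Rightarrow> (3 \<Rightarrow> complex \<Rightarrow> complex) \<Rightarrow> bool" where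
  "normal_primitive r k n W \<longleftrightarrow>
     (\<forall>j. W j holomorphic_on ball 0 r \<and> W j 0 = 0 \<and>
        (\<forall>t. \<bar>t\<bar> < r \<longrightarrow> deriv (W j) (of_real t) = of_real (cross3 (n t) (velocity k t) $ j))) \<and>
     (\<forall>t. \<bar>t\<bar> < r \<longrightarrow> norm (n t) = 1 \<and> n t \<bullet> velocity k t = 0) \<and>
     curvature_vector k 0 = norm (curvature_vector k 0) *\<^sub>R n 0 \<and>
     (\<exists>e. e \<noteq> 0 \<and> (\<forall>t. \<bar>t\<bar> < r \<longrightarrow> n t \<bullet> e = 0 \<and> velocity k t \<bullet> e = 0))"

lemma normal_primitive_mono:
  assumes "normal_primitive r k n W" "s \<le> r"
  shows "normal_primitive s k n W"
proof -
  have "W j holomorphic_on ball 0 s" for j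
    using assms unfolding normal_primitive_def by (meson holomorphic_on_subset subset_ball)
  then show ?thesis
    using assms unfolding normal_primitive_def by (meson less_le_trans)
qed

lemma bjoerling_normal_primitive:
  assumes X: "is_bjoerling \<Omega> I c X" and "open \<Omega>" "open I" "0 \<in> I" and I: "of_real ` I \<subseteq> \<Omega>"
  obtains n C W r where "r > 0" "ball 0 r \<subseteq> \<Omega>" "{-r<..<r} \<subseteq> I"
    "holomorphic_extension (ball 0 r) {-r<..<r} c C" "normal_primitive r c n W"
    "\<And>w j. w \<in> ball 0 r \<Longrightarrow> X w $ j = Re (C w $ j - \<i> * W j w)"
proof -
  obtain n C W r where n: "principal_normal_field I c n" and C: "holomorphic_extension \<Omega> I c C"
    and r: "r > 0" "ball 0 r \<subseteq> \<Omega>" "{-r<..<r} \<subseteq> I"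
    and W: "\<And>j. W j holomorphic_on ball 0 r" "\<And>j. W j 0 = 0"
      "\<And>j t. \<bar>t\<bar> < r \<Longrightarrow> deriv (W j) (of_real t) = of_real (cross3 (n t) (velocity c t) $ j)"
    and XW: "\<And>w j. w \<in> ball 0 r \<Longrightarrow> X w $ j = Re (C w $ j - \<i> * W j w)"
    by (rule bjoerling_local[OF assms]) (rule that)
  have tI: "t \<in> I" if "\<bar>t\<bar> < r" for t
  proof -
    have "t \<in> {-r<..<r}" using that by auto
    then show ?thesis using r(3) by blast
  qed
  obtain p e where e: "e \<noteq> 0" "c ` I \<subseteq> plane_through p e" "\<And>t. t \<in> I \<Longrightarrow> n t \<bullet> e = 0"
    using n unfolding principal_normal_field_def by blast
  have "velocity c t \<bullet> e = 0" if "t \<in> I" for t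
    using planar_velocity[OF \<open>open I\<close> that e(2)] holomorphic_extension_deriv(1)[OF C assms(2,3,5) that] by blast
  then have "\<exists>e. e \<noteq> 0 \<and> (\<forall>t. \<bar>t\<bar> < r \<longrightarrow> n t \<bullet> e = 0 \<and> velocity c t \<bullet> e = 0)"
    using e tI by blast
  then have "normal_primitive r c n W"
    using W n tI unfolding normal_primitive_def principal_normal_field_def by auto
  moreover have "holomorphic_extension (ball 0 r) {-r<..<r} c C"
    using C r(2,3) holomorphic_on_subset[OF _ r(2)] unfolding holomorphic_extension_def by blast
  ultimately show ?thesis using that[OF r _ _ XW] by blast
qed

section \<open>Determining the normal field from the curvature at the vertex\<close>

text \<open>A normal field comes with a plane of its own, with normal \<open>e\<close>, which has to
  be shown horizontal. At the vertex the velocity \<open>v\<close> spans the y-direction and the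
  curvature \<open>\<kappa>\<close> makes \<open>m\<close> horizontal, so \<open>m\<close> spans the
  x-direction and \<open>e\<close>, orthogonal to both, is vertical.\<close>

lemma horizontal_normal:
  fixes m v e x \<kappa> :: "real ^ 3"
  assumes "v $ 1 = 0" "v $ 3 = 0" "v \<noteq> 0" "m \<bullet> v = 0" "norm m = 1" "\<kappa> = norm \<kappa> *\<^sub>R m" "\<kappa> $ 3 = 0" "\<kappa> \<noteq> 0"
    "v \<bullet> e = 0" "m \<bullet> e = 0" "e \<noteq> 0" "x \<bullet> e = 0"
  shows "x $ 3 = 0" "m $ 2 = 0"
proof -
  have v2: "v $ 2 \<noteq> 0" using assms(1-3) by (auto simp: vec_eq_iff forall_3)
  then have m2: "m $ 2 = 0" and e2: "e $ 2 = 0" using assms by (auto simp: inner_real3)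
  have "norm \<kappa> * m $ 3 = 0" using assms(6,7) by (metis real_scaleR_def vector_scaleR_component)
  then have m3: "m $ 3 = 0" using \<open>\<kappa> \<noteq> 0\<close> by simp
  have "m $ 1 \<noteq> 0" using \<open>norm m = 1\<close> m2 m3 by (auto simp: norm_eq_1 inner_real3)
  then have "e $ 1 = 0" using \<open>m \<bullet> e = 0\<close> m2 m3 by (simp add: inner_real3)
  then have "e $ 3 \<noteq> 0" using \<open>e \<noteq> 0\<close> e2 by (auto simp: vec_eq_iff forall_3)
  then show "x $ 3 = 0" using \<open>x \<bullet> e = 0\<close> \<open>e $ 1 = 0\<close> e2 by (simp add: inner_real3)
  show "m $ 2 = 0" by (rule m2)
qed

text \<open>Both the normal and the velocity are horizontal, so their cross product is vertical and
  only \<open>W 3\<close> survives. Since the normal is a unit vector orthogonal to the velocity,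
  the square of that component is the squared speed, an identity that extends from the real axis to
  the disc.\<close>

lemma normal_primitive_horizontal:
  assumes W: "normal_primitive r k n W" and "r > 0"
    and K: "holomorphic_extension (ball 0 r) {-r<..<r} k K"
    and k3: "\<And>t. \<bar>t\<bar> < r \<Longrightarrow> k t $ 3 = 0"
    and v0: "velocity k 0 $ 1 = 0" "velocity k 0 \<noteq> 0" and curv: "curvature_vector k 0 \<noteq> 0"
  shows "\<And>z. z \<in> ball 0 r \<Longrightarrow> W 1 z = 0" "\<And>z. z \<in> ball 0 r \<Longrightarrow> W 2 z = 0"
    and "\<And>z. z \<in> ball 0 r \<Longrightarrow>
      (deriv (W 3) z)\<^sup>2 = (deriv (\<lambda>z. K z $ 1) z)\<^sup>2 + (deriv (\<lambda>z. K z $ 2) z)\<^sup>2"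
    and "deriv (W 3) 0 = of_real (n 0 $ 1 * velocity k 0 $ 2)" "velocity k 0 $ 2 \<noteq> 0"
proof -
  let ?J = "{-r<..<r}"
  have J: "open ?J" "of_real ` ?J \<subseteq> ball (0::complex) r" by auto
  have inJ: "t \<in> ?J" if "\<bar>t\<bar> < r" for t using that by auto
  have hol: "W j holomorphic_on ball 0 r" and W0: "W j 0 = 0"
    and dW: "\<And>t. \<bar>t\<bar> < r \<Longrightarrow> deriv (W j) (of_real t) = of_real (cross3 (n t) (velocity k t) $ j)"
    and n: "\<And>t. \<bar>t\<bar> < r \<Longrightarrow> norm (n t) = 1" "\<And>t. \<bar>t\<bar> < r \<Longrightarrow> n t \<bullet> velocity k t = 0"
    and \<kappa>: "curvature_vector k 0 = norm (curvature_vector k 0) *\<^sub>R n 0" for j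
    using W by (auto simp: normal_primitive_def)
  obtain e where e: "e \<noteq> 0" "\<And>t. \<bar>t\<bar> < r \<Longrightarrow> n t \<bullet> e = 0" "\<And>t. \<bar>t\<bar> < r \<Longrightarrow> velocity k t \<bullet> e = 0"
    using W unfolding normal_primitive_def by blast
  have dW': "deriv (W j) holomorphic_on ball 0 r" for j
    using hol by (intro holomorphic_deriv) auto
  have hK: "(\<lambda>z. K z $ j) holomorphic_on ball 0 r" for j using K by (auto simp: holomorphic_extension_def)
  have dK: "holomorphic_extension (ball 0 r) ?J (velocity k) (\<lambda>z. \<chi> j. deriv (\<lambda>\<zeta>. K \<zeta> $ j) z)"
    by (rule holomorphic_extension_deriv(2)[OF K open_ball J])
  have v3: "velocity k t $ 3 = 0" if "\<bar>t\<bar> < r" for t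
  proof -
    have "(k has_vector_derivative velocity k t) (at t)"
      by (rule holomorphic_extension_deriv(1)[OF K open_ball J inJ[OF that]])
    then have "((\<lambda>s. k s $ 3) has_vector_derivative velocity k t $ 3) (at t)"
      by (simp add: has_vector_derivative_cart)
    moreover have "((\<lambda>s. k s $ 3) has_vector_derivative 0) (at t)"
      by (rule has_vector_derivative_transform_within_open[OF has_vector_derivative_const J(1) inJ[OF that]])
        (use k3 in auto)
    ultimately show ?thesis using vector_derivative_unique_at by blast
  qed
  have a3: "velocity (velocity k) 0 $ 3 = 0"
  proof -
    have "(velocity k has_vector_derivative velocity (velocity k) 0) (at 0)"
      using holomorphic_extension_deriv(1)[OF dK open_ball J] \<open>r > 0\<close> by simp
    then have "((\<lambda>s. velocity k s $ 3) has_vector_derivative velocity (velocity k) 0 $ 3) (at 0)"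
      by (simp add: has_vector_derivative_cart)
    moreover have "((\<lambda>s. velocity k s $ 3) has_vector_derivative 0) (at 0)"
      by (rule has_vector_derivative_transform_within_open[OF has_vector_derivative_const J(1)])
        (use v3 \<open>r > 0\<close> in auto)
    ultimately show ?thesis using vector_derivative_unique_at by blast
  qed
  have \<kappa>3: "curvature_vector k 0 $ 3 = 0"
    using a3 v3[of 0] \<open>r > 0\<close> by (simp add: curvature_vector_def Let_def)
  have 0: "\<bar>0\<bar> < r" using \<open>r > 0\<close> by simp
  have n3: "n t $ 3 = 0" if "\<bar>t\<bar> < r" for t
    by (rule horizontal_normal(1)[OF v0(1) v3[OF 0] v0(2) n(2)[OF 0] n(1)[OF 0] \<kappa> \<kappa>3 curv
          e(3)[OF 0] e(2)[OF 0] e(1) e(2)[OF that]])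
  have n2: "n 0 $ 2 = 0"
    by (rule horizontal_normal(2)[OF v0(1) v3[OF 0] v0(2) n(2)[OF 0] n(1)[OF 0] \<kappa> \<kappa>3 curv
          e(3)[OF 0] e(2)[OF 0] e(1) e(2)[OF 0]])
  show "velocity k 0 $ 2 \<noteq> 0"
    using v0 v3[OF 0] by (auto simp: vec_eq_iff forall_3)
  show "deriv (W 3) 0 = of_real (n 0 $ 1 * velocity k 0 $ 2)"
    using dW[OF 0, of 3] n2 by (simp add: cross3_def)
  have Wz: "W j z = 0" if z: "z \<in> ball 0 r" and j: "j = 1 \<or> j = 2" for j z
  proof -
    have "deriv (W j) w = deriv (\<lambda>_. 0) w" if "w \<in> ball 0 r" for w
    proof -
      have "deriv (W j) w = (\<lambda>_. 0) w"
        by (rule holomorphic_eq_on_reals[OF dW' _ _ that])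
          (use j dW n3 v3 in \<open>auto simp: cross3_def\<close>)
      then show ?thesis by simp
    qed
    from eq_of_deriv_eq[OF hol _ this _ z] W0 show ?thesis by simp
  qed
  show "W 1 z = 0" "W 2 z = 0" if "z \<in> ball 0 r" for z using Wz[OF that] by auto
  show "(deriv (W 3) z)\<^sup>2 = (deriv (\<lambda>z. K z $ 1) z)\<^sup>2 + (deriv (\<lambda>z. K z $ 2) z)\<^sup>2"
    if z: "z \<in> ball 0 r" for z
  proof (rule holomorphic_eq_on_reals[OF _ _ _ z])
    show "(\<lambda>z. (deriv (W 3) z)\<^sup>2) holomorphic_on ball 0 r"
      by (intro holomorphic_intros dW')
    show "(\<lambda>z. (deriv (\<lambda>z. K z $ 1) z)\<^sup>2 + (deriv (\<lambda>z. K z $ 2) z)\<^sup>2) holomorphic_on ball 0 r"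
      by (intro holomorphic_intros hK) auto
    fix t assume t: "\<bar>t\<bar> < r"
    define a b x y where "a = n t $ 1" and "b = n t $ 2"
      and "x = velocity k t $ 1" and "y = velocity k t $ 2"
    have "a\<^sup>2 + b\<^sup>2 = 1" "a * x + b * y = 0"
      using n(1,2)[OF t] n3[OF t] v3[OF t]
      by (simp_all add: norm_eq_1 inner_real3 a_def b_def x_def y_def power2_eq_square)
    \<comment> \<open>Lagrange's identity in the plane.\<close>
    moreover have "(a * y - b * x)\<^sup>2 = (a\<^sup>2 + b\<^sup>2) * (x\<^sup>2 + y\<^sup>2) - (a * x + b * y)\<^sup>2"
      by (simp add: power2_eq_square algebra_simps)
    ultimately have "(a * y - b * x)\<^sup>2 = x\<^sup>2 + y\<^sup>2" by simp
    then have "(complex_of_real (a * y - b * x))\<^sup>2 = (of_real x)\<^sup>2 + (of_real y)\<^sup>2"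
      by (metis of_real_add of_real_power)
    moreover have "deriv (W 3) (of_real t) = of_real (a * y - b * x)"
      using dW[OF t, of 3] by (simp add: cross3_def a_def b_def x_def y_def)
    moreover have "deriv (\<lambda>z. K z $ 1) (of_real t) = of_real x" "deriv (\<lambda>z. K z $ 2) (of_real t) = of_real y"
      using dK inJ[OF t] by (auto simp: holomorphic_extension_def x_def y_def)
    ultimately show "(deriv (W 3) (of_real t))\<^sup>2 =
        (deriv (\<lambda>z. K z $ 1) (of_real t))\<^sup>2 + (deriv (\<lambda>z. K z $ 2) (of_real t))\<^sup>2"
      by simp
  qed
qed

text \<open>The two third components have derivatives with equal squares. Each normal field is
  aligned with the same nonzero curvature vector at the vertex, so these derivatives agree and are
  nonzero at 0, which selects the same square root.\<close>

lemma normal_primitive_unique: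
  assumes W: "normal_primitive r k n W" and V: "normal_primitive r k m V" and "r > 0"
    and K: "holomorphic_extension (ball 0 r) {-r<..<r} k K"
    and k3: "\<And>t. \<bar>t\<bar> < r \<Longrightarrow> k t $ 3 = 0"
    and v0: "velocity k 0 $ 1 = 0" "velocity k 0 \<noteq> 0" and curv: "curvature_vector k 0 \<noteq> 0"
    and z: "z \<in> ball 0 r"
  shows "W j z = V j z"
proof -
  note hW = normal_primitive_horizontal[OF W \<open>r > 0\<close> K k3 v0 curv]
  note hV = normal_primitive_horizontal[OF V \<open>r > 0\<close> K k3 v0 curv]
  have W3: "W 3 holomorphic_on ball 0 r" "V 3 holomorphic_on ball 0 r" "W 3 0 = V 3 0"
    using W V by (auto simp: normal_primitive_def)
  have "norm (curvature_vector k 0) *\<^sub>R n 0 = norm (curvature_vector k 0) *\<^sub>R m 0"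
    using W V unfolding normal_primitive_def by metis
  then have nm: "n 0 = m 0" using curv by simp
  have "norm (n 0) = 1" "curvature_vector k 0 = norm (curvature_vector k 0) *\<^sub>R n 0"
    using W \<open>r > 0\<close> by (auto simp: normal_primitive_def)
  have d0: "deriv (W 3) 0 = deriv (V 3) 0" using hW(4) hV(4) nm by simp
  have d0': "deriv (W 3) 0 \<noteq> 0"
  proof -
    have "(deriv (W 3) 0)\<^sup>2 = (deriv (\<lambda>z. K z $ 1) 0)\<^sup>2 + (deriv (\<lambda>z. K z $ 2) 0)\<^sup>2"
      using hW(3)[of 0] \<open>r > 0\<close> by simp
    moreover have "deriv (\<lambda>z. K z $ i) 0 = of_real (velocity k 0 $ i)" for i
    proof -
      have "holomorphic_extension (ball 0 r) {-r<..<r} (velocity k) (\<lambda>z. \<chi> j. deriv (\<lambda>\<zeta>. K \<zeta> $ j) z)"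
        by (rule holomorphic_extension_deriv(2)[OF K]) auto
      moreover have "0 \<in> {-r<..<r}" using \<open>r > 0\<close> by simp
      ultimately have "(\<chi> j. deriv (\<lambda>\<zeta>. K \<zeta> $ j) (of_real 0)) $ i = of_real (velocity k 0 $ i)"
        unfolding holomorphic_extension_def by blast
      then show ?thesis by simp
    qed
    ultimately show ?thesis using v0(1) hW(5) by auto
  qed
  have "deriv (W 3) w = deriv (V 3) w" if "w \<in> ball 0 r" for w
    by (rule holomorphic_eq_of_power2_eq[where f = "deriv (W 3)" and g = "deriv (V 3)",
          OF _ _ \<open>r > 0\<close> _ d0 d0' that])
      (use W3 hW(3) hV(3) in \<open>auto intro!: holomorphic_deriv\<close>)
  then have "W 3 z = V 3 z" by (rule eq_of_deriv_eq[OF W3(1,2) _ W3(3) z])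
  then show ?thesis using exhaust_3[of j] hW(1,2)[OF _ z] hV(1,2)[OF _ z] by auto
qed

text \<open>The reflection makes the first coordinate of \<open>K\<close> even and the second odd.
  The rotation hypothesis constrains only real parts of the null curve, but reality and parity
  supply the complementary parts on the imaginary axis, and the identity theorem turns the result
  into relations between holomorphic functions. In particular the third coordinate is a rotated copy
  of the second.\<close>

lemma cpg_pair_of_bjoerling:
  assumes W: "normal_primitive r k n W" and "r > 0"
    and K: "holomorphic_extension (ball 0 r) {-r<..<r} k K"
    and Y: "\<And>w j. w \<in> ball 0 r \<Longrightarrow> Y w $ j = Re (K w $ j - \<i> * W j w)"
    and k3: "\<And>t. \<bar>t\<bar> < r \<Longrightarrow> k t $ 3 = 0"
    and refl: "\<And>t. \<bar>t\<bar> < r \<Longrightarrow> reflect_line 0 (axis 1 1) (k t) = k (- t)"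
    and \<Lambda>: "\<And>t. \<bar>t\<bar> < r \<Longrightarrow> Y (\<i> * of_real t) = Lambda *v Y (of_real t)"
    and v0: "velocity k 0 \<noteq> 0" and curv: "curvature_vector k 0 \<noteq> 0"
  shows "velocity k 0 $ 1 = 0" "cpg_pair r (\<lambda>z. K z $ 1) (\<lambda>z. K z $ 2)"
    and "\<And>z j. z \<in> ball 0 r \<Longrightarrow>
      K z $ j - \<i> * W j z = (vector [K z $ 1, K z $ 2, - (K (\<i> * z) $ 2)] :: complex ^ 3) $ j"
proof -
  let ?J = "{-r<..<r}"
  have J: "open ?J" "of_real ` ?J \<subseteq> ball (0::complex) r" "0 \<in> ?J" using \<open>r > 0\<close> by auto
  have inJ: "t \<in> ?J" if "\<bar>t\<bar> < r" for t using that by auto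
  have 0: "0 \<in> ball (0::complex) r" using \<open>r > 0\<close> by simp
  have neg: "- z \<in> ball 0 r" and iz: "\<i> * z \<in> ball 0 r" if "z \<in> ball (0::complex) r" for z
    using that by (simp_all add: norm_mult)
  define K1 where "K1 z = K z $ 1" for z
  define K2 where "K2 z = K z $ 2" for z
  define P where "P = W 3"
  have hol: "K1 holomorphic_on ball 0 r" "K2 holomorphic_on ball 0 r" "(\<lambda>z. K z $ 3) holomorphic_on ball 0 r"
    "P holomorphic_on ball 0 r"
    using K W by (auto simp: holomorphic_extension_def normal_primitive_def K1_def [abs_def] K2_def [abs_def] P_def)
  have dhol: "deriv K1 holomorphic_on ball 0 r" "deriv K2 holomorphic_on ball 0 r" "deriv P holomorphic_on ball 0 r"
    using hol by (auto intro: holomorphic_deriv)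
  have Kre: "K1 (of_real t) = of_real (k t $ 1)" "K2 (of_real t) = of_real (k t $ 2)"
     "K (of_real t) $ 3 = 0" if "\<bar>t\<bar> < r" for t
    using K inJ[OF that] k3[OF that] by (simp_all add: holomorphic_extension_def K1_def K2_def)
  have kneg: "k (- t) $ 1 = k t $ 1" "k (- t) $ 2 = - k t $ 2" if "\<bar>t\<bar> < r" for t
    using refl[OF that, symmetric] by (simp_all add: reflect_line_e1)
  note arg = holomorphic_on_mult_arg
  have K1neg: "K1 (- 1 * z) = K1 z" if "z \<in> ball 0 r" for z
    by (rule holomorphic_eq_on_reals[OF arg[OF hol(1)] hol(1) _ that])
      (use Kre(1)[of "- _"] Kre(1) kneg(1) in auto)
  have K2neg: "K2 (- 1 * z) = - K2 z" if "z \<in> ball 0 r" for z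
    by (rule holomorphic_eq_on_reals[OF arg[OF hol(2)] _ _ that])
      (use Kre(2)[of "- _"] Kre(2) kneg(2) hol(2) in \<open>auto intro!: holomorphic_intros\<close>)
  have K3: "K z $ 3 = 0" if "z \<in> ball 0 r" for z
    by (rule holomorphic_eq_on_reals[OF hol(3) _ _ that]) (use Kre(3) in auto)
  have dK1neg: "deriv K1 (- z) = - deriv K1 z" if z: "z \<in> ball 0 r" for z
  proof -
    have "- 1 * deriv K1 (- 1 * z) = deriv (\<lambda>z. K1 (- 1 * z)) z"
      by (rule deriv_mult_arg[OF hol(1) _ z, symmetric]) simp
    also have "\<dots> = deriv K1 z" by (rule deriv_eq_on_ball[OF K1neg z])
    finally show ?thesis by (simp add: minus_equation_iff)
  qed
  have dK2neg: "deriv K2 (- z) = deriv K2 z" if z: "z \<in> ball 0 r" for z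
  proof -
    have "- 1 * deriv K2 (- 1 * z) = deriv (\<lambda>z. K2 (- 1 * z)) z"
      by (rule deriv_mult_arg[OF hol(2) _ z, symmetric]) simp
    also have "\<dots> = deriv (\<lambda>z. - K2 z) z" by (rule deriv_eq_on_ball[OF K2neg z])
    also have "\<dots> = - deriv K2 z"
      using z by (intro DERIV_imp_deriv DERIV_minus holomorphic_derivI[OF hol(2)]) auto
    finally show ?thesis by simp
  qed
  have dK: "holomorphic_extension (ball 0 r) ?J (velocity k) (\<lambda>z. \<chi> j. deriv (\<lambda>\<zeta>. K \<zeta> $ j) z)"
    by (rule holomorphic_extension_deriv(2)[OF K open_ball J(1,2)])
  have ddK: "holomorphic_extension (ball 0 r) ?J (velocity (velocity k))
      (\<lambda>z. \<chi> j. deriv (\<lambda>z. deriv (\<lambda>\<zeta>. K \<zeta> $ j) z) z)"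
    using holomorphic_extension_deriv(2)[OF dK open_ball J(1,2)] by (simp add: holomorphic_extension_def)
  have vel: "deriv K1 (of_real t) = of_real (velocity k t $ 1)" "deriv K2 (of_real t) = of_real (velocity k t $ 2)"
    if "\<bar>t\<bar> < r" for t
    using dK inJ[OF that] by (simp_all add: holomorphic_extension_def K1_def [abs_def] K2_def [abs_def])
  have "(\<chi> j. deriv (\<lambda>z. deriv (\<lambda>\<zeta>. K \<zeta> $ j) z) (of_real 0)) $ 1 =
      of_real (velocity (velocity k) 0 $ 1)"
    using ddK J(3) unfolding holomorphic_extension_def by blast
  then have acc: "deriv (deriv K1) 0 = of_real (velocity (velocity k) 0 $ 1)"
    by (simp add: K1_def [abs_def])
  have dK10: "deriv K1 0 = 0" using dK1neg[OF 0] by simp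
  then show v1: "velocity k 0 $ 1 = 0" using vel(1)[of 0] \<open>r > 0\<close> by simp
  note hor = normal_primitive_horizontal[OF W \<open>r > 0\<close> K k3 v1 v0 curv, folded K1_def K2_def P_def]
  have sq: "(deriv P z)\<^sup>2 = (deriv K1 z)\<^sup>2 + (deriv K2 z)\<^sup>2" if "z \<in> ball 0 r" for z
    using hor(3)[OF _ that] by (simp add: K1_def [abs_def] K2_def [abs_def])
  have v2: "velocity k 0 $ 2 \<noteq> 0" using hor(5) by simp
  have dK20: "deriv K2 0 = of_real (velocity k 0 $ 2)" using vel(2)[of 0] \<open>r > 0\<close> by simp
  have dP0: "deriv P 0 \<noteq> 0" using sq[OF 0] v2 by (auto simp: dK10 dK20)
  \<comment> \<open>The square of P' is even, and P' does not vanish at 0, so P' is even itself: a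
    sign change between z and -z is impossible.\<close>
  have dPneg: "deriv P (- 1 * z) = deriv P z" if "z \<in> ball 0 r" for z
  proof (rule holomorphic_eq_of_power2_eq[OF arg[OF dhol(3)] dhol(3) \<open>r > 0\<close> _ _ _ that])
    show "(deriv P (- 1 * w))\<^sup>2 = (deriv P w)\<^sup>2" if "w \<in> ball 0 r" for w
      using sq[OF that] sq[OF neg[OF that]] dK1neg[OF that] dK2neg[OF that] by simp
  qed (use dP0 in auto)
  have P0: "P 0 = 0" using W by (simp add: normal_primitive_def P_def)
  have Pneg: "P (- z) = - P z" if z: "z \<in> ball 0 r" for z
  proof -
    have "P (- 1 * z) = - P z"
    proof (rule eq_of_deriv_eq[OF arg[OF hol(4)] _ _ _ z])
      show "(\<lambda>z. - P z) holomorphic_on ball 0 r" by (intro holomorphic_intros hol)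
      show "deriv (\<lambda>z. P (- 1 * z)) w = deriv (\<lambda>z. - P z) w" if w: "w \<in> ball 0 r" for w
      proof -
        have "deriv (\<lambda>z. P (- 1 * z)) w = - 1 * deriv P (- 1 * w)"
          by (rule deriv_mult_arg[OF hol(4) _ w]) simp
        moreover have "deriv (\<lambda>z. - P z) w = - deriv P w"
          using w by (intro DERIV_imp_deriv DERIV_minus holomorphic_derivI[OF hol(4)]) auto
        ultimately show ?thesis using dPneg[OF w] by simp
      qed
    qed (simp_all add: P0)
    then show ?thesis by simp
  qed
  have Pre: "P (of_real t) \<in> \<real>" if "\<bar>t\<bar> < r" for t
  proof (rule real_on_reals[OF hol(4) _ _ that])
    show "deriv P (of_real s) \<in> \<real>" if "\<bar>s\<bar> < r" for s
      using W that by (simp add: normal_primitive_def P_def)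
  qed (simp add: P0)
  have cnj: "K1 (cnj z) = cnj (K1 z)" "K2 (cnj z) = cnj (K2 z)" "P (cnj z) = cnj (P z)" if "z \<in> ball 0 r" for z
    by (rule holomorphic_cnj_symmetric[OF _ _ that]; use hol Kre Pre in simp)+
  have Yc: "Y w $ 1 = Re (K1 w)" "Y w $ 2 = Re (K2 w)" "Y w $ 3 = Im (P w)" if "w \<in> ball 0 r" for w
    using Y[OF that] hor(1,2)[OF _ that] K3[OF that] by (simp_all add: K1_def K2_def P_def)
  \<comment> \<open>\<open>K1\<close> is even and real on the real axis, hence real on the imaginary
    axis; \<open>P\<close> is odd and real there, hence imaginary. \<open>\<Lambda>\<close> supplies
    precisely the parts not determined by this.\<close>
  have rot: "K1 (\<i> * of_real t) = - K1 (of_real t)" "P (\<i> * of_real t) = \<i> * K2 (of_real t)" if t: "\<bar>t\<bar> < r" for t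
  proof -
    have tb: "complex_of_real t \<in> ball 0 r" using t by simp
    have "Re (K1 (\<i> * of_real t)) = - k t $ 1" "Im (P (\<i> * of_real t)) = k t $ 2"
      using \<Lambda>[OF t] Yc[OF tb] Yc[OF iz[OF tb]] Kre[OF t]
      by (simp_all add: vec_eq_iff forall_3 Lambda_def matrix_vector_mult_def sum_3)
    moreover have "Im (K1 (\<i> * of_real t)) = 0"
      using arg_cong[OF cnj(1)[OF iz[OF tb]], of Im] K1neg[OF iz[OF tb]] by simp
    moreover have "Re (P (\<i> * of_real t)) = 0"
      using arg_cong[OF cnj(3)[OF iz[OF tb]], of Re] Pneg[OF iz[OF tb]] by simp
    ultimately show "K1 (\<i> * of_real t) = - K1 (of_real t)" "P (\<i> * of_real t) = \<i> * K2 (of_real t)"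
      using Kre[OF t] by (simp_all add: complex_eq_iff)
  qed
  have K1i: "K1 (\<i> * z) = - K1 z" if "z \<in> ball 0 r" for z
    by (rule holomorphic_eq_on_reals[OF arg[OF hol(1)] _ _ that])
      (use rot hol in \<open>auto intro!: holomorphic_intros\<close>)
  have Pi: "P (\<i> * z) = \<i> * K2 z" if "z \<in> ball 0 r" for z
    by (rule holomorphic_eq_on_reals[OF arg[OF hol(4)] _ _ that])
      (use rot hol in \<open>auto intro!: holomorphic_intros\<close>)
  have PK2: "P z = - \<i> * K2 (\<i> * z)" if z: "z \<in> ball 0 r" for z
  proof -
    have "- P z = \<i> * K2 (\<i> * z)" using Pi[OF iz[OF z]] Pneg[OF z] by simp
    from arg_cong[OF this, of uminus] show ?thesis by simp
  qed
  have dPK2: "deriv P z = deriv K2 (\<i> * z)" if z: "z \<in> ball 0 r" for z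
  proof -
    have "deriv P z = deriv (\<lambda>z. - \<i> * K2 (\<i> * z)) z" by (rule deriv_eq_on_ball[OF PK2 z])
    also have "\<dots> = - \<i> * (\<i> * deriv K2 (\<i> * z))"
      by (intro DERIV_imp_deriv DERIV_cmult has_field_derivative_mult_arg[OF hol(2) _ z]) simp
    finally show ?thesis by simp
  qed
  \<comment> \<open>The value of P'(0) computed from the rotation is compared with the one computed
    from the cross product. The sense of rotation of \<open>Lambda\<close> forces the normal at the
    vertex to be (1, 0, 0) rather than its opposite, and the curvature follows it; hence the
    positive second derivative required of a pair.\<close>
  have "deriv P 0 = of_real (velocity k 0 $ 2)" using dPK2[OF 0] dK20 by simp
  with hor(4) have "complex_of_real (n 0 $ 1 * velocity k 0 $ 2) = of_real (velocity k 0 $ 2)" by simp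
  then have "n 0 $ 1 * velocity k 0 $ 2 = velocity k 0 $ 2" by (simp only: of_real_eq_iff)
  then have n1: "n 0 $ 1 = 1" using v2 by simp
  have "curvature_vector k 0 = norm (curvature_vector k 0) *\<^sub>R n 0"
    using W by (simp add: normal_primitive_def)
  then have "curvature_vector k 0 $ 1 = norm (curvature_vector k 0)"
    by (metis mult.right_neutral n1 real_scaleR_def vector_scaleR_component)
  moreover have "curvature_vector k 0 $ 1 = velocity (velocity k) 0 $ 1 / (velocity k 0 \<bullet> velocity k 0)"
    using v1 by (simp add: curvature_vector_def Let_def)
  ultimately have "velocity (velocity k) 0 $ 1 / (velocity k 0 \<bullet> velocity k 0) > 0" using curv by simp
  moreover have "velocity k 0 \<bullet> velocity k 0 > 0" using v0 by simp
  ultimately have "velocity (velocity k) 0 $ 1 > 0" by (simp add: zero_less_divide_iff)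
  then show "cpg_pair r (\<lambda>z. K z $ 1) (\<lambda>z. K z $ 2)"
    unfolding K1_def[symmetric] K2_def[symmetric] cpg_pair_def
    using hol(1,2) cnj(1,2) K1i K2neg sq dPK2 dK20 v2 acc by auto
  show "K z $ j - \<i> * W j z = (vector [K z $ 1, K z $ 2, - (K (\<i> * z) $ 2)] :: complex ^ 3) $ j"
    if z: "z \<in> ball 0 r" for z j
    using exhaust_3[of j] hor(1,2)[OF _ z] K3[OF z] PK2[OF z] by (auto simp: K1_def K2_def P_def)
qed

section \<open>Comparing the given surface with the one in a suitable parameter\<close>

text \<open>Substitution in the Bjoerling integral: rotations of determinant 1 commute with the
  cross product, and the velocity picks up the factor of the chain rule. This holds for either sign
  of that factor, so the orientation of \<open>\<phi>\<close> does not disturb the sign of the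
  normal.\<close>

lemma normal_primitive_rigid:
  assumes W: "normal_primitive r1 c n W" and C: "holomorphic_extension (ball 0 r1) {-r1<..<r1} c C"
    and A: "orthogonal_matrix A" "det A = 1"
    and \<Phi>: "\<Phi> holomorphic_on ball 0 r" "\<Phi> ` ball 0 r \<subseteq> ball 0 r1"
      "\<And>t. \<bar>t\<bar> < r \<Longrightarrow> \<Phi> (of_real t) = of_real (\<phi> t)"
    and "\<phi> 0 = 0" "velocity \<phi> 0 \<noteq> 0" "r > 0"
    and k: "\<And>t. \<bar>t\<bar> < r \<Longrightarrow> k t = A *v c (\<phi> t) + b"
  shows "normal_primitive r k (\<lambda>t. A *v n (\<phi> t)) (\<lambda>j z. \<Sum>i\<in>UNIV. of_real (A $ j $ i) * W i (\<Phi> z))"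
    and "velocity k 0 = velocity \<phi> 0 *\<^sub>R (A *v velocity c 0)"
    and "curvature_vector k 0 = A *v curvature_vector c 0"
proof -
  let ?J = "{-r<..<r}" and ?I = "{-r1<..<r1}"
  have tb: "complex_of_real t \<in> ball 0 r" if "\<bar>t\<bar> < r" for t using that by simp
  have \<phi>I: "\<bar>\<phi> t\<bar> < r1" if "\<bar>t\<bar> < r" for t
  proof -
    have "\<Phi> (of_real t) \<in> ball 0 r1" using \<Phi>(2) tb[OF that] by blast
    then show ?thesis using \<Phi>(3)[OF that] by simp
  qed
  then have \<phi>J: "\<phi> ` ?J \<subseteq> ?I" by (auto simp: abs_less_iff minus_less_iff)
  have J: "open ?J" "0 \<in> ?J" "of_real ` ?I \<subseteq> ball (0::complex) r1" "0 \<in> ?I"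
    using \<open>r > 0\<close> \<phi>I[of 0] \<open>\<phi> 0 = 0\<close> by auto
  have inJ: "t \<in> ?J" if "\<bar>t\<bar> < r" for t using that by auto
  have c: "(c has_vector_derivative velocity c t) (at t)" if "t \<in> ?I" for t
    by (rule holomorphic_extension_deriv(1)[OF C open_ball _ J(3) that]) simp
  have c2: "(velocity c has_vector_derivative velocity (velocity c) t) (at t)" if "t \<in> ?I" for t
    by (rule holomorphic_extension_deriv(1)[OF holomorphic_extension_deriv(2)[OF C open_ball _ J(3)]
          open_ball _ J(3) that]) simp_all
  have \<phi>': "(\<phi> has_vector_derivative velocity \<phi> t) (at t)"
    "deriv \<Phi> (of_real t) = of_real (velocity \<phi> t)" if "t \<in> ?J" for t
    by (rule real_extension_derivative[OF \<Phi>(1) open_ball _ _ that]; use \<Phi>(3) tb in auto)+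
  have \<phi>'': "(velocity \<phi> has_vector_derivative velocity (velocity \<phi>) 0) (at 0)"
  proof (rule real_extension_derivative(1)[OF _ open_ball J(1) _ J(2)])
    show "deriv \<Phi> holomorphic_on ball 0 r" using \<Phi>(1) by (intro holomorphic_deriv) auto
  qed (use \<phi>'(2) tb in auto)
  have kJ: "k s = A *v c (\<phi> s) + b" if "s \<in> ?J" for s using that by (intro k) auto
  note rigid = rigid_reparametrization[OF A(1) J(1) \<phi>J kJ c \<phi>'(1)]
  have vel: "velocity k t = velocity \<phi> t *\<^sub>R (A *v velocity c (\<phi> t))" if "t \<in> ?J" for t
    by (rule rigid(1)) (use that in auto)
  show "velocity k 0 = velocity \<phi> 0 *\<^sub>R (A *v velocity c 0)"
    using vel[OF J(2)] \<open>\<phi> 0 = 0\<close> by simp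
  have "curvature_vector k 0 = A *v curvature_vector c (\<phi> 0)"
    by (rule rigid(2)) (use J(2,4) \<open>\<phi> 0 = 0\<close> \<open>velocity \<phi> 0 \<noteq> 0\<close> c2 \<phi>'' in auto)
  then show curv: "curvature_vector k 0 = A *v curvature_vector c 0" using \<open>\<phi> 0 = 0\<close> by simp
  have hW: "W j holomorphic_on ball 0 r1" and W0: "W j 0 = 0" for j
    using W by (auto simp: normal_primitive_def)
  have dW: "deriv (W j) (of_real t) = of_real (cross3 (n t) (velocity c t) $ j)" if "\<bar>t\<bar> < r1" for j t
    using W that by (simp add: normal_primitive_def)
  have n: "norm (n t) = 1" "n t \<bullet> velocity c t = 0" if "\<bar>t\<bar> < r1" for t
    using W that by (auto simp: normal_primitive_def)
  obtain e where e: "e \<noteq> 0" "\<And>t. \<bar>t\<bar> < r1 \<Longrightarrow> n t \<bullet> e = 0" "\<And>t. \<bar>t\<bar> < r1 \<Longrightarrow> velocity c t \<bullet> e = 0"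
    using W unfolding normal_primitive_def by blast
  have \<Phi>0: "\<Phi> 0 = 0" using \<Phi>(3)[of 0] \<open>r > 0\<close> \<open>\<phi> 0 = 0\<close> by simp
  have D: "((\<lambda>z. \<Sum>i\<in>UNIV. of_real (A $ j $ i) * W i (\<Phi> z)) has_field_derivative
      (\<Sum>i\<in>UNIV. of_real (A $ j $ i) * (deriv (W i) (\<Phi> z) * deriv \<Phi> z))) (at z)"
    if z: "z \<in> ball 0 r" for z j
  proof -
    have "\<Phi> z \<in> ball 0 r1" using \<Phi>(2) z by blast
    then have "(W i has_field_derivative deriv (W i) (\<Phi> z)) (at (\<Phi> z))" for i
      by (intro holomorphic_derivI[OF hW]) auto
    moreover have "(\<Phi> has_field_derivative deriv \<Phi> z) (at z)"
      by (rule holomorphic_derivI[OF \<Phi>(1) open_ball z])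
    ultimately have "((\<lambda>z. W i (\<Phi> z)) has_field_derivative deriv (W i) (\<Phi> z) * deriv \<Phi> z) (at z)" for i
      by (rule DERIV_chain2)
    then show ?thesis by (intro DERIV_sum DERIV_cmult)
  qed
  show "normal_primitive r k (\<lambda>t. A *v n (\<phi> t)) (\<lambda>j z. \<Sum>i\<in>UNIV. of_real (A $ j $ i) * W i (\<Phi> z))"
    unfolding normal_primitive_def
  proof (intro conjI allI impI)
    fix j
    show "(\<lambda>z. \<Sum>i\<in>UNIV. of_real (A $ j $ i) * W i (\<Phi> z)) holomorphic_on ball 0 r"
      using D by (meson field_differentiable_at_within field_differentiable_def holomorphic_onI)
    show "(\<Sum>i\<in>UNIV. of_real (A $ j $ i) * W i (\<Phi> 0)) = 0" by (simp add: \<Phi>0 W0)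
    fix t assume t: "\<bar>t\<bar> < r"
    have "deriv (\<lambda>z. \<Sum>i\<in>UNIV. of_real (A $ j $ i) * W i (\<Phi> z)) (of_real t) =
        (\<Sum>i\<in>UNIV. of_real (A $ j $ i) *
          (of_real (cross3 (n (\<phi> t)) (velocity c (\<phi> t)) $ i) * of_real (velocity \<phi> t)))"
      unfolding DERIV_imp_deriv[OF D[OF tb[OF t]]] \<Phi>(3)[OF t] dW[OF \<phi>I[OF t]] \<phi>'(2)[OF inJ[OF t]] ..
    also have "\<dots> = of_real ((velocity \<phi> t *\<^sub>R (A *v cross3 (n (\<phi> t)) (velocity c (\<phi> t)))) $ j)"
      by (simp add: matrix_vector_mult_def sum_distrib_left mult_ac)
    also have "velocity \<phi> t *\<^sub>R (A *v cross3 (n (\<phi> t)) (velocity c (\<phi> t))) = cross3 (A *v n (\<phi> t)) (velocity k t)"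
      by (simp add: vel[OF inJ[OF t]] cross_mult_right cross3_rotation[OF A])
    finally show "deriv (\<lambda>z. \<Sum>i\<in>UNIV. of_real (A $ j $ i) * W i (\<Phi> z)) (of_real t) =
        of_real (cross3 (A *v n (\<phi> t)) (velocity k t) $ j)" .
  next
    fix t assume t: "\<bar>t\<bar> < r"
    show "norm (A *v n (\<phi> t)) = 1"
      using n(1)[OF \<phi>I[OF t]] by (simp add: norm_orthogonal_matrix[OF A(1)])
    show "(A *v n (\<phi> t)) \<bullet> velocity k t = 0"
      unfolding vel[OF inJ[OF t]] using n(2)[OF \<phi>I[OF t]] by (simp add: inner_orthogonal_matrix[OF A(1)])
  next
    have "curvature_vector c 0 = norm (curvature_vector c 0) *\<^sub>R n 0"
      using W by (simp add: normal_primitive_def)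
    from arg_cong[OF this, of "(*v) A"]
    have "A *v curvature_vector c 0 = norm (curvature_vector c 0) *\<^sub>R (A *v n 0)"
      by (simp only: matrix_vector_mult_scaleR)
    then show "curvature_vector k 0 = norm (curvature_vector k 0) *\<^sub>R (A *v n (\<phi> 0))"
      unfolding curv norm_orthogonal_matrix[OF A(1)] \<open>\<phi> 0 = 0\<close> .
  next
    show "\<exists>e. e \<noteq> 0 \<and> (\<forall>t. \<bar>t\<bar> < r \<longrightarrow> (A *v n (\<phi> t)) \<bullet> e = 0 \<and> velocity k t \<bullet> e = 0)"
    proof (intro exI conjI allI impI)
      show "A *v e \<noteq> 0" using e(1) by (simp add: orthogonal_matrix_eq_0_iff[OF A(1)])
      fix t assume t: "\<bar>t\<bar> < r"
      show "(A *v n (\<phi> t)) \<bullet> (A *v e) = 0"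
        using e(2)[OF \<phi>I[OF t]] by (simp add: inner_orthogonal_matrix[OF A(1)])
      show "velocity k t \<bullet> (A *v e) = 0"
        unfolding vel[OF inJ[OF t]] using e(3)[OF \<phi>I[OF t]] by (simp add: inner_orthogonal_matrix[OF A(1)])
    qed
  qed
qed

lemma holomorphic_extension_subset:
  "\<lbrakk>holomorphic_extension \<Omega> I g G; \<Omega>' \<subseteq> \<Omega>; I' \<subseteq> I\<rbrakk> \<Longrightarrow> holomorphic_extension \<Omega>' I' g G"
  unfolding holomorphic_extension_def by (auto intro: holomorphic_on_subset)

text \<open>Two Bjoerling representations meet here: that of X over \<Omega>, pulled back by the
  extension of \<open>\<phi>\<close> and moved by \<open>M\<close>, and that of the surface Y over
  its own domain. They have the same curve \<open>k\<close>, so uniqueness of the extension and of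
  the primitive identifies their null curves near 0. The adjoint is then read off from the imaginary
  part.\<close>

lemma self_CPG_null_curve:
  assumes I: "open I" "0 \<in> I" and \<Omega>: "open \<Omega>" "of_real ` I \<subseteq> \<Omega>"
    and suit: "suitable_parameter I c J \<phi>" and nd: "nondegenerate c"
    and X: "is_bjoerling \<Omega> I c X" and adj: "adjoint_surface \<Omega> X Xs"
  obtains r A B \<Phi> Q d where "r > 0" "cpg_pair r A B" "{-r<..<r} \<subseteq> J"
    "\<Phi> holomorphic_on ball 0 r" "inj_on \<Phi> (ball 0 r)" "\<Phi> ` ball 0 r \<subseteq> \<Omega>"
    "\<And>t. \<bar>t\<bar> < r \<Longrightarrow> \<Phi> (of_real t) = of_real (\<phi> t)"
    "orthogonal_matrix Q" "det Q = 1"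
    "\<And>z. z \<in> ball 0 r \<Longrightarrow> Xs (\<Phi> z) = Q *v vector [Im (A z), Im (B z), - Im (B (\<i> * z))] + d"
proof -
  have J: "symmetric_interval J" and \<phi>: "regular_analytic_curve J \<phi>" "\<And>s. s \<in> J \<Longrightarrow> \<phi> (- s) = - \<phi> s"
    using suit unfolding suitable_parameter_def by simp_all
  obtain T k \<Omega>0 Y where T: "rigid_motion T" "k = T \<circ> c \<circ> \<phi>"
    and k': "\<forall>s\<in>J. k s $ 3 = 0 \<and> reflect_line 0 (axis 1 1) (k s) = k (- s)"
    and \<Omega>0: "symmetric_domain \<Omega>0" "of_real ` J \<subseteq> \<Omega>0" and Y: "is_bjoerling \<Omega>0 J k Y"
    and \<Lambda>': "\<forall>s\<in>J. Y (\<i> * of_real s) = Lambda *v Y (of_real s)"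
    using suit unfolding suitable_parameter_def by (elim conjE exE) (rule that)
  have k: "k s $ 3 = 0" "reflect_line 0 (axis 1 1) (k s) = k (- s)" if "s \<in> J" for s
    using k' that by simp_all
  have \<Lambda>: "Y (\<i> * of_real s) = Lambda *v Y (of_real s)" if "s \<in> J" for s
    using \<Lambda>' that by simp
  have J': "open J" "0 \<in> J" and \<Omega>0': "open \<Omega>0"
    using J \<Omega>0 by (auto simp: symmetric_interval_def symmetric_domain_def)
  obtain M b where M: "orthogonal_matrix M" "det M = 1" and Tb: "T = (\<lambda>x. M *v x + b)"
    using T(1) unfolding rigid_motion_def by blast
  have kM: "k s = M *v c (\<phi> s) + b" for s by (simp add: T(2) Tb)
  have \<phi>0: "\<phi> 0 = 0" using \<phi>(2)[OF J'(2)] by simp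
  have v\<phi>: "velocity \<phi> 0 \<noteq> 0" using \<phi>(1) J'(2) by (simp add: regular_analytic_curve_def)
  have vc: "velocity c 0 \<noteq> 0" using X I(2) by (simp add: is_bjoerling_def regular_analytic_curve_def)
  obtain n C W r1 where r1: "r1 > 0" "ball 0 r1 \<subseteq> \<Omega>" "{-r1<..<r1} \<subseteq> I"
    and C: "holomorphic_extension (ball 0 r1) {-r1<..<r1} c C" and W: "normal_primitive r1 c n W"
    and XW: "\<And>w j. w \<in> ball 0 r1 \<Longrightarrow> X w $ j = Re (C w $ j - \<i> * W j w)"
    by (rule bjoerling_normal_primitive[OF X \<Omega>(1) I \<Omega>(2)]) (rule that)
  obtain m K V r2 where r2: "r2 > 0" "ball 0 r2 \<subseteq> \<Omega>0" "{-r2<..<r2} \<subseteq> J"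
    and K: "holomorphic_extension (ball 0 r2) {-r2<..<r2} k K" and V: "normal_primitive r2 k m V"
    and YV: "\<And>w j. w \<in> ball 0 r2 \<Longrightarrow> Y w $ j = Re (K w $ j - \<i> * V j w)"
    by (rule bjoerling_normal_primitive[OF Y \<Omega>0' J' \<Omega>0(2)]) (rule that)
  have \<phi>a: "real_analytic_on \<phi> J" using \<phi>(1) by (simp add: regular_analytic_curve_def)
  obtain r3 F where r3: "r3 > 0" and F: "F holomorphic_on ball 0 r3"
    and F\<phi>: "\<And>t. \<bar>t\<bar> < r3 \<Longrightarrow> F (of_real t) = complex_of_real (\<phi> t)"
    by (rule real_analytic_holomorphic_extension[OF \<phi>a J'(2)]) (rule that)
  have F0: "F 0 = 0" using F\<phi>[of 0] r3 \<phi>0 by simp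
  have "deriv F (of_real 0) = of_real (velocity \<phi> 0)"
    by (rule real_extension_derivative(2)[OF F, of "{-r3<..<r3}"]) (use F\<phi> r3 in auto)
  then have "deriv F 0 \<noteq> 0" using v\<phi> by simp
  then obtain r4 where r4: "r4 > 0" "ball 0 r4 \<subseteq> ball (0::complex) r3" "inj_on F (ball 0 r4)"
    using has_complex_derivative_locally_injective[OF F, of 0] r3 by auto
  have "isCont F 0"
    using holomorphic_on_imp_continuous_on[OF F] r3 by (simp add: continuous_on_eq_continuous_at)
  then obtain r5 where r5: "r5 > 0" "F ` ball 0 r5 \<subseteq> ball 0 r1"
    using r1(1) F0 unfolding continuous_at_ball by metis
  \<comment> \<open>Small enough for the representation of Y, for \<open>F\<close> to be injective,
    and for its image to lie in the disc where X is represented.\<close>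
  define r where "r = min r2 (min r4 r5)"
  have r: "r > 0" "r \<le> r2" "r \<le> r4" "r \<le> r5" using r2 r4 r5 by (auto simp: r_def)
  have rb: "ball 0 r \<subseteq> ball (0::complex) r2" "ball 0 r \<subseteq> ball (0::complex) r4" "ball 0 r \<subseteq> ball (0::complex) r5"
    using r by auto
  have rJ: "t \<in> J" if "\<bar>t\<bar> < r" for t
  proof -
    have "t \<in> {-r2<..<r2}" using that r by auto
    then show ?thesis using r2(3) by blast
  qed
  have Fr: "F holomorphic_on ball 0 r" "F ` ball 0 r \<subseteq> ball 0 r1" "inj_on F (ball 0 r)"
    using holomorphic_on_subset[OF F subset_trans[OF rb(2) r4(2)]] subset_trans[OF image_mono[OF rb(3)] r5(2)]
      inj_on_subset[OF r4(3) rb(2)] by blast+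
  have F\<phi>r: "F (of_real t) = of_real (\<phi> t)" if "\<bar>t\<bar> < r" for t
  proof (rule F\<phi>)
    have "complex_of_real t \<in> ball 0 r" using that by simp
    then have "complex_of_real t \<in> ball 0 r3" using rb r4(2) by blast
    then show "\<bar>t\<bar> < r3" by simp
  qed
  define U where "U j z = (\<Sum>i\<in>UNIV. complex_of_real (M $ j $ i) * W i (F z))" for j z
  note rigid = normal_primitive_rigid[OF W C M Fr(1,2) F\<phi>r \<phi>0 v\<phi> r(1) kM]
  have U: "normal_primitive r k (\<lambda>t. M *v n (\<phi> t)) U"
    unfolding U_def [abs_def] by (rule rigid(1))
  have vk: "velocity k 0 \<noteq> 0"
    using rigid(2) v\<phi> vc by (simp add: orthogonal_matrix_eq_0_iff[OF M(1)])
  have curv: "curvature_vector k 0 \<noteq> 0"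
    using rigid(3) nd by (simp add: nondegenerate_def orthogonal_matrix_eq_0_iff[OF M(1)])
  have Kr: "holomorphic_extension (ball 0 r) {-r<..<r} k K"
    by (rule holomorphic_extension_subset[OF K rb(1)]) (use r(2) in auto)
  have Vr: "normal_primitive r k m V" by (rule normal_primitive_mono[OF V r(2)])
  have Y': "Y w $ j = Re (K w $ j - \<i> * V j w)" if "w \<in> ball 0 r" for w j
    using YV rb(1) that by blast
  note cpg = cpg_pair_of_bjoerling[OF Vr r(1) Kr Y' k(1)[OF rJ] k(2)[OF rJ] \<Lambda>[OF rJ] vk curv]
  have v1: "velocity k 0 $ 1 = 0" by (rule cpg(1))
  have P: "cpg_pair r (\<lambda>z. K z $ 1) (\<lambda>z. K z $ 2)" by (rule cpg(2))
  have KV: "K z $ j - \<i> * V j z = (vector [K z $ 1, K z $ 2, - (K (\<i> * z) $ 2)] :: complex ^ 3) $ j"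
    if "z \<in> ball 0 r" for z j
    by (rule cpg(3)) (use that in auto)
  \<comment> \<open>\<open>U\<close> comes from the normal of \<open>c\<close> carried along,
    \<open>V\<close> from the normal chosen for \<open>k\<close>; both are normal primitives of the
    same curve.\<close>
  have UV: "U j z = V j z" if "z \<in> ball 0 r" for j z
    by (rule normal_primitive_unique[OF U Vr r(1) Kr k(1)[OF rJ] v1 vk curv that])
  have KC: "K z $ j = (\<Sum>i\<in>UNIV. of_real (M $ j $ i) * C (F z) $ i) + of_real (b $ j)"
    if "z \<in> ball 0 r" for z j
  proof (rule holomorphic_eq_on_reals[OF _ _ _ that])
    show "(\<lambda>z. K z $ j) holomorphic_on ball 0 r" using Kr by (simp add: holomorphic_extension_def)
    have "(\<lambda>z. C (F z) $ i) holomorphic_on ball 0 r" for i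
      using holomorphic_on_compose_gen[OF Fr(1) _ Fr(2), of "\<lambda>z. C z $ i"] C
      by (simp add: o_def holomorphic_extension_def)
    then show "(\<lambda>z. (\<Sum>i\<in>UNIV. of_real (M $ j $ i) * C (F z) $ i) + of_real (b $ j)) holomorphic_on ball 0 r"
      by (intro holomorphic_intros)
    fix t assume t: "\<bar>t\<bar> < r"
    then have "F (of_real t) \<in> ball 0 r1" using Fr(2) by (auto simp: image_subset_iff)
    then have "\<phi> t \<in> {-r1<..<r1}" by (auto simp: F\<phi>r[OF t])
    then have "C (F (of_real t)) $ i = of_real (c (\<phi> t) $ i)" for i
      using C F\<phi>r[OF t] by (simp add: holomorphic_extension_def)
    moreover have "K (of_real t) $ j = of_real (k t $ j)"
    proof -
      have "t \<in> {-r<..<r}" using t by auto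
      then show ?thesis using Kr by (simp add: holomorphic_extension_def)
    qed
    ultimately show "K (of_real t) $ j =
        (\<Sum>i\<in>UNIV. of_real (M $ j $ i) * C (F (of_real t)) $ i) + of_real (b $ j)"
      by (simp add: kM matrix_vector_mult_def)
  qed
  have hF: "(\<lambda>z. C z $ j - \<i> * W j z) holomorphic_on ball 0 r1" for j
    using C W unfolding holomorphic_extension_def normal_primitive_def by (intro holomorphic_intros) auto
  obtain d where d: "\<And>z j. z \<in> ball 0 r1 \<Longrightarrow> Xs z $ j = Im (C z $ j - \<i> * W j z) + d $ j"
    by (rule adjoint_re_holomorphic[OF adj r1(2) hF XW]) (assumption, rule that)
  have Xs: "Xs (F z) = transpose M *v vector [Im (K z $ 1), Im (K z $ 2), - Im (K (\<i> * z) $ 2)] + d"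
    if z: "z \<in> ball 0 r" for z
  proof -
    have Fz: "F z \<in> ball 0 r1" using Fr(2) z by blast
    \<comment> \<open>The adjoint of X before translation. Rotating it by \<open>M\<close> gives the
      imaginary part of the null curve of \<open>k\<close>, since the translation \<open>b\<close>
      is real and drops out.\<close>
    define g where "g = (\<chi> i. Im (C (F z) $ i - \<i> * W i (F z)))"
    have "(M *v g) $ j = Im (K z $ j - \<i> * V j z)" for j
      unfolding UV[OF z, symmetric] KC[OF z] U_def
      by (simp add: g_def matrix_vector_mult_def sum_distrib_left right_diff_distrib flip: sum_subtractf)
    then have "(M *v g) $ j = (vector [Im (K z $ 1), Im (K z $ 2), - Im (K (\<i> * z) $ 2)] :: real ^ 3) $ j" for j
      unfolding KV[OF z] using exhaust_3[of j] by auto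
    then have "M *v g = vector [Im (K z $ 1), Im (K z $ 2), - Im (K (\<i> * z) $ 2)]"
      by (simp add: vec_eq_iff)
    then have "g = transpose M *v vector [Im (K z $ 1), Im (K z $ 2), - Im (K (\<i> * z) $ 2)]"
      by (metis transpose_orthogonal_matrix_cancel[OF M(1)])
    moreover have "Xs (F z) = g + d" using d[OF Fz] by (simp add: g_def vec_eq_iff)
    ultimately show ?thesis by simp
  qed
  show ?thesis
  proof (rule that[OF r(1) P _ Fr(1,3) _ F\<phi>r _ _ Xs])
    show "{-r<..<r} \<subseteq> J" using rJ by auto
    show "F ` ball 0 r \<subseteq> \<Omega>" using Fr(2) r1(2) by blast
    show "orthogonal_matrix (transpose M)" using M(1) by (simp add: orthogonal_matrix_transpose)
    show "det (transpose M) = 1" using M(2) by (simp add: det_transpose)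
  qed
qed

section \<open>The adjoint surface along the bisector\<close>

text \<open>The inverse of the rotation R of the overview: it carries the normalized surface back to
  the imaginary part of the null curve.\<close>

definition bisector_rotation :: "real ^ 3 ^ 3" where
  "bisector_rotation = vector [vector [1, 0, 0],
     vector [0, 1 / sqrt 2, 1 / sqrt 2],
     vector [0, - 1 / sqrt 2, 1 / sqrt 2]]"

lemma bisector_rotation: "orthogonal_matrix bisector_rotation" "det bisector_rotation = 1"
  by (simp_all add: bisector_rotation_def orthogonal_matrix matrix_matrix_mult_def transpose_def mat_def
      vec_eq_iff forall_3 sum_3 det_3)

lemma cpg_surface_adjoint:
  assumes P: "cpg_pair r A B" and z: "z \<in> ball 0 r"
  shows "vector [Im (A (\<omega> * z)), Im (B (\<omega> * z)), - Im (B (\<i> * (\<omega> * z)))] =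
    bisector_rotation *v cpg_surface (\<lambda>z. - \<i> * A (\<omega> * z))
      (\<lambda>z. - \<i> / of_real (sqrt 2) * (B (\<omega> * z) + B (\<i> * \<omega> * z))) z"
proof -
  define u where "u = \<omega> * z"
  have "u \<in> ball 0 r" using z by (simp add: u_def norm_mult omega)
  then have Bn: "B (- u) = - B u" using P by (simp add: cpg_pair_def)
  have iu: "\<omega> * (\<i> * z) = \<i> * u" "\<i> * \<omega> * (\<i> * z) = - u" "\<i> * \<omega> * z = \<i> * u"
    by (simp_all add: u_def mult.left_commute mult.assoc)
  have s: "Re (- \<i> / of_real (sqrt 2) * x) = Im x / sqrt 2" for x
    by (simp add: Re_divide_of_real)
  have S: "cpg_surface (\<lambda>z. - \<i> * A (\<omega> * z)) (\<lambda>z. - \<i> / of_real (sqrt 2) * (B (\<omega> * z) + B (\<i> * \<omega> * z))) z =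
      vector [Im (A u), (Im (B u) + Im (B (\<i> * u))) / sqrt 2, (Im (B u) - Im (B (\<i> * u))) / sqrt 2]"
    unfolding cpg_surface_def iu u_def[symmetric] s Bn by (simp add: diff_divide_distrib)
  have "((x + y) / sqrt 2 + (x - y) / sqrt 2) / sqrt 2 = x"
    "(- ((x + y) / sqrt 2) + (x - y) / sqrt 2) / sqrt 2 = - y" for x y :: real
    by (simp_all add: field_simps)
  then show ?thesis
    unfolding S u_def[symmetric]
    by (simp add: bisector_rotation_def vec_eq_iff forall_3 matrix_vector_mult_def sum_3
        flip: add_divide_distrib diff_divide_distrib)
qed

theorem theorem2p9:
  fixes I :: "real set" and \<Omega> :: "complex set"
    and c :: "real \<Rightarrow> real ^ 3" and X Xs :: "complex \<Rightarrow> real ^ 3"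
  assumes "symmetric_interval I"
    and "symmetric_domain \<Omega>"
    and "of_real ` I \<subseteq> \<Omega>"
    and "minimal_surface \<Omega> X"
    and "self_CPG I c"
    and "is_bjoerling \<Omega> I c X"
    and "adjoint_surface \<Omega> X Xs"
  shows "\<exists>J \<gamma> cs.
           self_CPG J cs \<and> generated_along \<Omega> Xs J \<gamma> cs \<and>
           (suitable_parameter I c I (\<lambda>t. t) \<longrightarrow> affine_arc J \<gamma>)"

proof -
  have I: "open I" "0 \<in> I" and \<Omega>: "open \<Omega>" and nd: "nondegenerate c"
    using assms by (auto simp: symmetric_interval_def symmetric_domain_def self_CPG_def)
  obtain J0 \<phi>0 where suit0: "suitable_parameter I c J0 \<phi>0"
    using \<open>self_CPG I c\<close> unfolding self_CPG_def by blast
  \<comment> \<open>If the given parameter is itself suitable, it must be the one used, because the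
    arc then has to be a straight segment; otherwise any suitable parameter will do.\<close>
  define \<phi> where "\<phi> = (if suitable_parameter I c I (\<lambda>t. t) then (\<lambda>t. t) else \<phi>0)"
  define J' where "J' = (if suitable_parameter I c I (\<lambda>t. t) then I else J0)"
  have suit: "suitable_parameter I c J' \<phi>" using suit0 by (simp add: \<phi>_def J'_def)
  obtain r0 A B \<Phi> Q d where r0: "r0 > 0" and P: "cpg_pair r0 A B"
    and \<Phi>: "\<Phi> holomorphic_on ball 0 r0" "inj_on \<Phi> (ball 0 r0)" "\<Phi> ` ball 0 r0 \<subseteq> \<Omega>"
      "\<And>t. \<bar>t\<bar> < r0 \<Longrightarrow> \<Phi> (of_real t) = of_real (\<phi> t)"
    and Q: "orthogonal_matrix Q" "det Q = 1"
    and Xs: "\<And>z. z \<in> ball 0 r0 \<Longrightarrow>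
      Xs (\<Phi> z) = Q *v vector [Im (A z), Im (B z), - Im (B (\<i> * z))] + d"
    by (rule self_CPG_null_curve[OF I \<Omega> assms(3) suit nd assms(6,7)]) (rule that)
  let ?A = "\<lambda>z. - \<i> * A (\<omega> * z)"
  let ?B = "\<lambda>z. - \<i> / of_real (sqrt 2) * (B (\<omega> * z) + B (\<i> * \<omega> * z))"
  obtain r where r: "0 < r" "r \<le> r0" and P': "cpg_pair r ?A ?B"
    and nv: "\<And>z. z \<in> ball 0 r \<Longrightarrow> deriv ?B z \<noteq> 0"
    using cpg_pair_nonvanishing[OF cpg_pair_adjoint[OF P r0] r0] by blast
  have sub: "ball 0 r \<subseteq> ball (0::complex) r0" using r by auto
  have \<omega>b: "\<omega> * z \<in> ball 0 r0" if "z \<in> ball 0 r" for z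
    using that r by (simp add: norm_mult omega)
  define \<Psi> where "\<Psi> z = \<Phi> (\<omega> * z)" for z
  have \<Psi>: "\<Psi> holomorphic_on ball 0 r" "inj_on \<Psi> (ball 0 r)" "\<Psi> ` ball 0 r \<subseteq> \<Omega>"
  proof -
    show "\<Psi> holomorphic_on ball 0 r"
      unfolding \<Psi>_def [abs_def]
      using holomorphic_on_subset[OF holomorphic_on_mult_arg[OF \<Phi>(1), of \<omega>] sub] by (simp add: omega)
    show "inj_on \<Psi> (ball 0 r)"
    proof (rule inj_onI)
      fix x y assume "x \<in> ball 0 r" "y \<in> ball 0 r" "\<Psi> x = \<Psi> y"
      then have "\<omega> * x = \<omega> * y" using inj_onD[OF \<Phi>(2) _ \<omega>b \<omega>b] by (simp add: \<Psi>_def)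
      then show "x = y" using omega(2) by auto
    qed
    show "\<Psi> ` ball 0 r \<subseteq> \<Omega>" using \<omega>b \<Phi>(3) by (auto simp: \<Psi>_def)
  qed
  have Q': "orthogonal_matrix (Q ** bisector_rotation)" "det (Q ** bisector_rotation) = 1"
    using Q bisector_rotation by (simp_all add: orthogonal_matrix_mul det_mul)
  have Xs': "Xs (\<Psi> z) = (Q ** bisector_rotation) *v cpg_surface ?A ?B z + d" if z: "z \<in> ball 0 r" for z
  proof -
    have "z \<in> ball 0 r0" using sub z by blast
    then show ?thesis
      unfolding \<Psi>_def Xs[OF \<omega>b[OF z]] matrix_vector_mul_assoc[symmetric]
      using cpg_surface_adjoint[OF P] by simp
  qed
  note gen = cpg_pair_generates[OF P' nv r(1) \<Psi> Q' Xs']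
  have "affine_arc {-r<..<r} (\<lambda>t. \<Psi> (of_real t))" if id: "suitable_parameter I c I (\<lambda>t. t)"
  proof -
    \<comment> \<open>\<open>\<Phi>\<close> extends the identity of the real axis, so it is the
      identity and the arc is the segment t |-> t \<omega>.\<close>
    have "\<Phi> z = z" if "z \<in> ball 0 r0" for z
      by (rule holomorphic_eq_on_reals[OF \<Phi>(1) _ _ that])
        (use \<Phi>(4) id in \<open>auto simp: \<phi>_def intro!: holomorphic_intros\<close>)
    then have "\<Psi> z = \<omega> * z" if "z \<in> ball 0 r" for z
      using \<omega>b[OF that] by (simp add: \<Psi>_def)
    then have "\<forall>t\<in>{-r<..<r}. \<Psi> (of_real t) = 0 + of_real t * \<omega>" by (auto simp: mult.commute)
    moreover have "\<omega> \<noteq> 0" using omega(2) by auto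
    ultimately show ?thesis unfolding affine_arc_def by blast
  qed
  then show ?thesis using gen by blast
qed

end
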